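(* Let $\pi:X\to Y$ be a factor code on an SFT $X$ and $\nu$ an ergodic measure on $Y$. Then there exists an ergodic $c_{\pi,\nu}$-fold class separating relative joining over $\nu$, where $c_{\pi,\nu}$ is the class degree of $\nu$.
   Context: An SFT is a two-sided shift of finite type with finite alphabet; a factor code $\pi:X\to Y$ is a shift-commuting continuous surjection onto a shift space $Y$. "Measure" means Borel probability measure, "ergodic measure" an ergodic shift-invariant measure; maps applied to measures mean pushforward. Transition classes: for $y\in Y$ and $x,x'\in\pi^{-1}(y)$, say there is a transition from $x$ to $x'$ if for every integer $n$ there is $z\in X$ with $\pi(z)=y$, $z_i=x_i$ for all $i\le n$, and $z_i=x'_i$ for all sufficiently large $i$ (for a 1-block code on a 1-step SFT: infinitely many times to the right one can pass from $x$ to $x'$ via finite $X$-words while keeping the same image $y$). Write $x\sim x'$ if there is a transition from $x$ to $x'$ and one from $x'$ to $x$. This is an equivalence relation on $\pi^{-1}(y)$ with finitely many classes, called transition classes over $y$; $[x]$ denotes the class of $x$. For an ergodic measure $\nu$ on $Y$, $\nu$-a.e. $y$ has the same finite number of transition classes over it; this number is the class degree $c_{\pi,\nu}$ of $\nu$. An $n$-fold ($\pi$-)relative joining is a measure $\lambda$ on $X^n$, invariant under the product shift action, such that $\pi(x^{(1)})=\dots=\pi(x^{(n)})$ for $\lambda$-a.e. $(x^{(1)},\dots,x^{(n)})$. With $p_i:X^n\to X$ the $i$-th projection, it is over $\nu$ if $\pi p_i\lambda=\nu$ for some (hence every) $i$. It is class separating if for $\lambda$-a.e. $(x^{(1)},\dots,x^{(n)})$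 the points $x^{(1)},\dots,x^{(n)}$ lie in $n$ different transition classes over their common image. *)

theory Defs
  imports "HOL-Probability.Probability"
begin

text \<open>
  Finite alphabets carry the discrete topology, so that the library's product topology on
  \<open>int \<Rightarrow> 'a\<close> is the usual topology of the full shift.
\<close>

class alphabet = finite + discrete_topology

instance alphabet \<subseteq> second_countable_topology
proof
  show "\<exists>B::'a::alphabet set set. countable B \<and> open = generate_topology B"
  proof (intro exI conjI)
    show "countable (UNIV :: 'a set set)"
      by (rule countable_finite) simp
    show "open = generate_topology (UNIV :: 'a set set)"
      by (intro ext) (simp add: Topological_Spaces.open_discrete generate_topology.Basis)
  qed
qed

instance bool :: alphabet ..


subsection \<open>Shift spaces and factor codes\<close>

definition shift :: "(int \<Rightarrow> 'a) \<Rightarrow> int \<Rightarrow> 'a" where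
  "shift x = (\<lambda>i. x (i + 1))"

definition shift_space :: "(int \<Rightarrow> 'a::alphabet) set \<Rightarrow> bool" where
  "shift_space X \<longleftrightarrow> closed X \<and> shift ` X = X"

definition occurs_at :: "'a list \<Rightarrow> (int \<Rightarrow> 'a) \<Rightarrow> int \<Rightarrow> bool" where
  "occurs_at w x i \<longleftrightarrow> (\<forall>k<length w. x (i + int k) = w ! k)"

definition SFT :: "(int \<Rightarrow> 'a::alphabet) set \<Rightarrow> bool" where
  "SFT X \<longleftrightarrow> (\<exists>F. finite F \<and> X = {x. \<forall>w\<in>F. \<forall>i. \<not> occurs_at w x i})"

definition factor_code ::
  "(int \<Rightarrow> 'a::alphabet) set \<Rightarrow> (int \<Rightarrow> 'b::alphabet) set \<Rightarrow>
    ((int \<Rightarrow> 'a) \<Rightarrow> (int \<Rightarrow> 'b)) \<Rightarrow> bool" where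
  "factor_code X Y \<pi> \<longleftrightarrow>
     shift_space X \<and> shift_space Y \<and> continuous_on X \<pi> \<and> \<pi> ` X = Y \<and>
     (\<forall>x\<in>X. \<pi> (shift x) = shift (\<pi> x))"


subsection \<open>Transition classes\<close>

definition fiber ::
  "(int \<Rightarrow> 'a) set \<Rightarrow> ((int \<Rightarrow> 'a) \<Rightarrow> (int \<Rightarrow> 'b)) \<Rightarrow> (int \<Rightarrow> 'b) \<Rightarrow> (int \<Rightarrow> 'a) set" where
  "fiber X \<pi> y = {x \<in> X. \<pi> x = y}"

definition transition ::
  "(int \<Rightarrow> 'a) set \<Rightarrow> ((int \<Rightarrow> 'a) \<Rightarrow> (int \<Rightarrow> 'b)) \<Rightarrow> (int \<Rightarrow> 'b) \<Rightarrow>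
    (int \<Rightarrow> 'a) \<Rightarrow> (int \<Rightarrow> 'a) \<Rightarrow> bool" where
  "transition X \<pi> y x x' \<longleftrightarrow>
     (\<forall>n. \<exists>z\<in>X. \<pi> z = y \<and> (\<forall>i\<le>n. z i = x i) \<and> (\<exists>m. \<forall>i\<ge>m. z i = x' i))"

definition transition_equiv ::
  "(int \<Rightarrow> 'a) set \<Rightarrow> ((int \<Rightarrow> 'a) \<Rightarrow> (int \<Rightarrow> 'b)) \<Rightarrow> (int \<Rightarrow> 'b) \<Rightarrow>
    ((int \<Rightarrow> 'a) \<times> (int \<Rightarrow> 'a)) set" where
  "transition_equiv X \<pi> y =
     {(x, x'). x \<in> fiber X \<pi> y \<and> x' \<in> fiber X \<pi> y \<and>
        transition X \<pi> y x x' \<and> transition X \<pi> y x' x}"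

definition transition_classes ::
  "(int \<Rightarrow> 'a) set \<Rightarrow> ((int \<Rightarrow> 'a) \<Rightarrow> (int \<Rightarrow> 'b)) \<Rightarrow> (int \<Rightarrow> 'b) \<Rightarrow> (int \<Rightarrow> 'a) set set" where
  "transition_classes X \<pi> y = fiber X \<pi> y // transition_equiv X \<pi> y"

definition transition_class ::
  "(int \<Rightarrow> 'a) set \<Rightarrow> ((int \<Rightarrow> 'a) \<Rightarrow> (int \<Rightarrow> 'b)) \<Rightarrow> (int \<Rightarrow> 'a) \<Rightarrow> (int \<Rightarrow> 'a) set" where
  "transition_class X \<pi> x = transition_equiv X \<pi> (\<pi> x) `` {x}"


subsection \<open>Borel probability measures, invariance, ergodicity\<close>

definition borel_prob_measure :: "'a::topological_space set \<Rightarrow> 'a measure \<Rightarrow> bool" where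
  "borel_prob_measure S M \<longleftrightarrow> prob_space M \<and> sets M = sets (restrict_space borel S)"

definition invariant_measure :: "('a \<Rightarrow> 'a) \<Rightarrow> 'a measure \<Rightarrow> bool" where
  "invariant_measure T M \<longleftrightarrow> T \<in> measurable M M \<and> distr M M T = M"

definition ergodic_measure :: "('a \<Rightarrow> 'a) \<Rightarrow> 'a measure \<Rightarrow> bool" where
  "ergodic_measure T M \<longleftrightarrow>
     invariant_measure T M \<and>
     (\<forall>A\<in>sets M. T -` A \<inter> space M = A \<longrightarrow> measure M A = 0 \<or> measure M A = 1)"

text \<open>
  The description is meaningful for ergodic \<open>\<nu>\<close>: almost every point then has the
  same finite number of transition classes over it.
\<close>

definition class_degree ::
  "(int \<Rightarrow> 'a) set \<Rightarrow> ((int \<Rightarrow> 'a) \<Rightarrow> (int \<Rightarrow> 'b)) \<Rightarrow> (int \<Rightarrow> 'b) measure \<Rightarrow> nat" where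
  "class_degree X \<pi> \<nu> =
     (THE c. AE y in \<nu>. finite (transition_classes X \<pi> y) \<and> card (transition_classes X \<pi> y) = c)"


subsection \<open>Relative joinings\<close>

text \<open>
  The power \<open>X\<^sup>n\<close> consists of the functions on \<open>{..<n}\<close> with values in \<open>X\<close> (extended by
  \<open>undefined\<close>). Since the coordinates outside \<open>{..<n}\<close> are constant, the topology it inherits
  from \<open>nat \<Rightarrow> int \<Rightarrow> 'a\<close> is the product topology.
\<close>

definition power_space :: "nat \<Rightarrow> 'a set \<Rightarrow> (nat \<Rightarrow> 'a) set" where
  "power_space n X = (\<Pi>\<^sub>E k\<in>{..<n}. X)"

definition power_shift :: "nat \<Rightarrow> (nat \<Rightarrow> int \<Rightarrow> 'a) \<Rightarrow> nat \<Rightarrow> int \<Rightarrow> 'a" where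
  "power_shift n x = (\<lambda>k\<in>{..<n}. shift (x k))"

definition relative_joining ::
  "(int \<Rightarrow> 'a::alphabet) set \<Rightarrow> ((int \<Rightarrow> 'a) \<Rightarrow> (int \<Rightarrow> 'b)) \<Rightarrow> nat \<Rightarrow>
    (nat \<Rightarrow> int \<Rightarrow> 'a) measure \<Rightarrow> bool" where
  "relative_joining X \<pi> n L \<longleftrightarrow>
     borel_prob_measure (power_space n X) L \<and>
     invariant_measure (power_shift n) L \<and>
     (AE x in L. \<forall>i<n. \<forall>j<n. \<pi> (x i) = \<pi> (x j))"

definition joining_over ::
  "((int \<Rightarrow> 'a) \<Rightarrow> (int \<Rightarrow> 'b)) \<Rightarrow> nat \<Rightarrow>
    (nat \<Rightarrow> int \<Rightarrow> 'a) measure \<Rightarrow> (int \<Rightarrow> 'b) measure \<Rightarrow> bool" where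
  "joining_over \<pi> n L \<nu> \<longleftrightarrow> (\<exists>i<n. distr L \<nu> (\<lambda>x. \<pi> (x i)) = \<nu>)"

definition class_separating ::
  "(int \<Rightarrow> 'a) set \<Rightarrow> ((int \<Rightarrow> 'a) \<Rightarrow> (int \<Rightarrow> 'b)) \<Rightarrow> nat \<Rightarrow>
    (nat \<Rightarrow> int \<Rightarrow> 'a) measure \<Rightarrow> bool" where
  "class_separating X \<pi> n L \<longleftrightarrow>
     (AE x in L. inj_on (\<lambda>i. transition_class X \<pi> (x i)) {..<n})"

end

theory Submission
  imports Defs
begin

text \<open>
  The idea is to find a compact shift-invariant set of \<open>c\<close>-tuples, \<open>c\<close> being the class degree, all of
  which are class separating, and to lift \<open>\<nu>\<close> to an ergodic measure on this set.

  Since \<open>X\<close> is of finite type and \<open>\<pi>\<close> is a sliding block code, points of \<open>X\<close> that agree on a window of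
  some radius \<open>R\<close> can be glued there without changing the image (\<open>gluing_code_SFT\<close>). Two points \<open>x\<close>, \<open>x'\<close> over
  the same \<open>y\<close> are inequivalent iff from some time \<open>n\<close> on there is no finite path over \<open>y\<close> that leads
  from \<open>x\<close> to \<open>x'\<close>, or none that leads from \<open>x'\<close> to \<open>x\<close>. For fixed \<open>n\<close> this is a closed condition, and it gets
  weaker as \<open>n\<close> grows. So the \<open>k\<close>-tuples of points over a common \<open>y\<close> that are pairwise separated in this
  sense from time \<open>n\<close> on form a compact set \<open>tuples k n\<close>, increasing in \<open>n\<close>, and the shift turns \<open>n\<close> into
  \<open>n - 1\<close>. A point \<open>y\<close> has at least \<open>k\<close> transition classes iff it lies in the projection \<open>over k n\<close> of
  \<open>tuples k n\<close> for some \<open>n\<close> (\<open>card_classes_ge_iff\<close>). The set of these \<open>y\<close> is Borel and invariant, so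
  ergodicity shows that the number of classes is almost surely constant (\<open>class_degree_over\<close>).

  By invariance \<open>\<nu> (over c n)\<close> does not depend on \<open>n\<close> (\<open>measure_over_eq\<close>). Letting \<open>n\<close> tend to infinity shows that
  the common value is \<open>1\<close>; letting \<open>n\<close> tend to minus infinity shows that almost every \<open>y\<close> lies in all
  \<open>over c n\<close>, and by compactness such a \<open>y\<close> carries a tuple in the intersection \<open>core c\<close> of all \<open>tuples c n\<close>
  (\<open>image_core\<close>). This intersection is compact and shift-invariant, and its elements are class separating.

  It remains to lift an ergodic measure through a factor map from a compact zero-dimensional system whose
  image has full measure (\<open>ergodic_lift\<close>). Measures are handled as finitely additive functions on clopen
  sets, where Tychonoff's theorem provides compactness. A lift exists by compactness, an invariant
  one by averaging (\<open>lift_contents_nonempty\<close>). An invariant lift that maximises a strictly convex functional is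
  extreme among the invariant lifts, hence ergodic: otherwise it would be a combination of its conditional
  measures on an invariant set and on the complement, and these are again lifts of \<open>\<nu>\<close> because an
  invariant measure that is absolutely continuous with respect to \<open>\<nu>\<close> equals \<open>\<nu>\<close>
  (\<open>ergodic_absolutely_continuous_eq\<close>).
\<close>

section \<open>Zero-dimensional spaces and their Borel measures\<close>

text \<open>
  Countability makes a basis of open sets generate the Borel sets, stability under intersections
  makes a probability measure determined by its values on the basis, and closedness of the members
  allows measures to be built from set functions on clopen sets.
\<close>

definition clopen_basis :: "'z::topological_space set set \<Rightarrow> bool" where
  "clopen_basis \<B> \<longleftrightarrow>
     topological_basis \<B> \<and> countable \<B> \<and> (\<forall>U\<in>\<B>. closed U) \<and> Int_stable \<B>"

lemma clopen_basis_discrete: "clopen_basis (UNIV :: 'a::alphabet set set)"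
  unfolding clopen_basis_def
proof (intro conjI)
  show "topological_basis (UNIV :: 'a set set)"
    by (rule topological_basisI) (auto simp: Topological_Spaces.open_discrete)
  show "countable (UNIV :: 'a set set)"
    by (rule countable_finite) simp
  show "\<forall>U\<in>(UNIV :: 'a set set). closed U"
    by (simp add: closed_def Topological_Spaces.open_discrete)
qed (simp add: Int_stable_def)

text \<open>
  Boxes with finitely many constrained coordinates. Applied twice, starting from a finite alphabet, this
  covers both the full shift and the space of sequences of points of the full shift.
\<close>

lemma clopen_basis_fun:
  fixes \<B> :: "'z::topological_space set set"
  assumes "clopen_basis \<B>"
  shows "\<exists>\<C> :: ('i::countable \<Rightarrow> 'z) set set. clopen_basis \<C>"
proof -
  define \<S> where "\<S> = (\<lambda>(i::'i, U). {x. x i \<in> U}) ` (UNIV \<times> \<B>)"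
  define \<C> where "\<C> = Inter ` {F. finite F \<and> F \<subseteq> \<S>}"
  have B: "topological_basis \<B>" "countable \<B>" "\<And>U. U \<in> \<B> \<Longrightarrow> closed U" "\<And>U. U \<in> \<B> \<Longrightarrow> open U"
    using assms by (auto simp: clopen_basis_def topological_basis_open)
  have S_open: "open S" and S_closed: "closed S" if "S \<in> \<S>" for S
  proof -
    from that obtain i U where S: "S = (\<lambda>x. x i) -` U" and U: "U \<in> \<B>"
      by (auto simp: \<S>_def)
    show "open S" unfolding S
      using B(4)[OF U] by (intro open_vimage) auto
    show "closed S" unfolding S
      using B(3)[OF U] by (intro closed_vimage) auto
  qed
  have "topological_basis \<C>"
  proof (rule topological_basisI)
    show "open U" if "U \<in> \<C>" for U
      using that S_open by (auto simp: \<C>_def intro!: open_Inter)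
    fix O' and x :: "'i \<Rightarrow> 'z"
    assume "open O'" "x \<in> O'"
    then obtain X where X: "x \<in> Pi\<^sub>E UNIV X" "\<And>i. open (X i)" "finite {i. X i \<noteq> UNIV}"
        "Pi\<^sub>E UNIV X \<subseteq> O'"
      using product_topology_open_contains_basis[of "\<lambda>_. euclidean" UNIV O' x]
      by (auto simp: open_fun_def)
    have "\<exists>U\<in>\<B>. x i \<in> U \<and> U \<subseteq> X i" for i
      using topological_basisE[OF B(1) X(2)] X(1) by (metis PiE_mem UNIV_I)
    then obtain U where U: "\<And>i. U i \<in> \<B>" "\<And>i. x i \<in> U i" "\<And>i. U i \<subseteq> X i"
      by metis
    define F where "F = (\<lambda>i. {z::'i \<Rightarrow> 'z. z i \<in> U i}) ` {i. X i \<noteq> UNIV}"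
    have "F \<subseteq> \<S>" "finite F"
      using U(1) X(3) by (auto simp: F_def \<S>_def)
    then have "\<Inter>F \<in> \<C>"
      by (auto simp: \<C>_def)
    moreover have "x \<in> \<Inter>F"
      using U(2) by (auto simp: F_def)
    moreover have "\<Inter>F \<subseteq> Pi\<^sub>E UNIV X"
    proof
      fix z assume "z \<in> \<Inter>F"
      then have "z i \<in> X i" for i
        using U(3)[of i] by (cases "X i = UNIV") (auto simp: F_def)
      then show "z \<in> Pi\<^sub>E UNIV X"
        by auto
    qed
    ultimately show "\<exists>B'\<in>\<C>. x \<in> B' \<and> B' \<subseteq> O'"
      using X(4) by (intro bexI[of _ "\<Inter>F"] conjI subset_trans[of "\<Inter>F" "Pi\<^sub>E UNIV X" O'])
  qed
  moreover have "countable \<C>"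
    unfolding \<C>_def \<S>_def
    by (intro countable_image countable_Collect_finite_subset) (simp add: B(2))
  moreover have "\<forall>U\<in>\<C>. closed U"
    using S_closed by (auto simp: \<C>_def)
  moreover have "Int_stable \<C>"
  proof (rule Int_stableI)
    fix a b assume "a \<in> \<C>" "b \<in> \<C>"
    then obtain F G where "finite F" "F \<subseteq> \<S>" "a = \<Inter>F" "finite G" "G \<subseteq> \<S>" "b = \<Inter>G"
      by (auto simp: \<C>_def)
    then have "a \<inter> b = \<Inter>(F \<union> G)" "finite (F \<union> G)" "F \<union> G \<subseteq> \<S>"
      by auto
    then show "a \<inter> b \<in> \<C>"
      by (auto simp: \<C>_def)
  qed
  ultimately show ?thesis
    by (auto simp: clopen_basis_def)
qed

lemma compact_PiE_UNIV:
  fixes A :: "'i \<Rightarrow> 'z::topological_space set"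
  assumes "\<And>i. compact (A i)"
  shows "compact (Pi\<^sub>E UNIV A)"
  using assms compactin_PiE[of "\<lambda>_. euclidean" "UNIV :: 'i set" A]
  by (simp add: euclidean_product_topology)

lemma compact_nested:
  fixes A :: "nat \<Rightarrow> 'z::topological_space set"
  assumes "\<And>n. compact (A n)" "decseq A" "\<And>n. A n \<noteq> {}" "\<And>n. closed (A n)"
  shows "(\<Inter>n. A n) \<noteq> {}"
proof -
  have "A 0 \<inter> (\<Inter>n\<in>UNIV. A n) \<noteq> {}"
  proof (rule compact_imp_fip_image)
    fix I' :: "nat set" assume "finite I'"
    then have "A (Max (insert 0 I')) \<subseteq> A 0 \<inter> (\<Inter>i\<in>I'. A i)"
      by (intro Int_greatest INT_greatest decseqD[OF assms(2)]) auto
    then show "A 0 \<inter> (\<Inter>i\<in>I'. A i) \<noteq> {}"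
      using assms(3) by (metis subset_empty)
  qed (auto intro: assms)
  then show ?thesis by auto
qed

lemma sets_restrict_borel_eq_sigma:
  fixes K :: "'z::topological_space set"
  assumes "clopen_basis \<B>" "K \<in> sets borel"
  shows "sets (restrict_space borel K) = sigma_sets K ((\<inter>) K ` \<B>)"
proof -
  have *: "borel = sigma UNIV \<B>"
    using assms(1) by (intro borel_eq_countable_basis) (auto simp: clopen_basis_def)
  have "sets (borel :: 'z measure) = sigma_sets UNIV \<B>"
    unfolding * by (rule sets_measure_of) simp
  then have "K \<in> sigma_sets UNIV \<B>"
    using assms(2) by simp
  from sigma_sets_Int[OF this] show ?thesis
    by (simp add: sets_restrict_space *)
qed

lemma space_borel_prob_measure: "borel_prob_measure S M \<Longrightarrow> space M = S"
  unfolding borel_prob_measure_def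
  by (metis sets_eq_imp_space_eq space_borel space_restrict_space2 space_restrict_space inf_top.right_neutral)

text \<open>
  The traces of the basis on \<open>K\<close> form an intersection-stable generator of the Borel sets of \<open>K\<close>.
\<close>

lemma borel_prob_measure_eqI:
  assumes \<B>: "clopen_basis \<B>" and K: "K \<in> sets borel"
    and M: "borel_prob_measure K M" and N: "borel_prob_measure K N"
    and eq: "\<And>U. U \<in> \<B> \<Longrightarrow> measure M (K \<inter> U) = measure N (K \<inter> U)"
  shows "M = N"
proof -
  interpret M: prob_space M using M by (simp add: borel_prob_measure_def)
  interpret N: prob_space N using N by (simp add: borel_prob_measure_def)
  note gen = sets_restrict_borel_eq_sigma[OF \<B> K]
  show ?thesis
  proof (rule measure_eqI_generator_eq_countable)
    show "Int_stable ((\<inter>) K ` \<B>)"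
    proof (rule Int_stableI)
      fix a b assume "a \<in> (\<inter>) K ` \<B>" "b \<in> (\<inter>) K ` \<B>"
      then obtain U V where "U \<in> \<B>" "V \<in> \<B>" "a \<inter> b = K \<inter> (U \<inter> V)"
        by auto
      then show "a \<inter> b \<in> (\<inter>) K ` \<B>"
        using \<B> by (auto simp: clopen_basis_def Int_stable_def)
    qed
    show "emeasure M X = emeasure N X" if "X \<in> (\<inter>) K ` \<B>" for X
      using that eq by (auto simp: M.emeasure_eq_measure N.emeasure_eq_measure)
    show "sets M = sigma_sets K ((\<inter>) K ` \<B>)" "sets N = sigma_sets K ((\<inter>) K ` \<B>)"
      using M N gen by (auto simp: borel_prob_measure_def)
    show "\<Union>((\<inter>) K ` \<B>) = K"
    proof -
      have "\<exists>U\<in>\<B>. x \<in> U" for x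
        using \<B> topological_basisE[of \<B> UNIV x] by (auto simp: clopen_basis_def)
      then show ?thesis by auto
    qed
  qed (use \<B> in \<open>auto simp: clopen_basis_def\<close>)
qed

lemma measurable_borel_prob_measure:
  assumes "borel_prob_measure K M" "continuous_on K f" "f ` K \<subseteq> L"
    "sets N = sets (restrict_space borel L)"
  shows "f \<in> measurable M N"
proof -
  have "f \<in> measurable (restrict_space borel K) (restrict_space borel L)"
    using assms(2,3)
    by (intro measurable_restrict_space2 borel_measurable_continuous_on_restrict)
       (auto simp: space_restrict_space)
  then show ?thesis
    using assms measurable_cong_sets[of M "restrict_space borel K" N "restrict_space borel L"]
    by (auto simp: borel_prob_measure_def)
qed

lemma borel_prob_measure_distr:
  assumes "borel_prob_measure K M" "f \<in> measurable M N" "sets N = sets (restrict_space borel L)"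
  shows "borel_prob_measure L (distr M N f)"
  using assms by (auto simp: borel_prob_measure_def intro: prob_space.prob_space_distr)

section \<open>From contents on clopen sets to measures\<close>

definition clopens :: "'z::topological_space set \<Rightarrow> 'z set set" where
  "clopens K = {C. openin (top_of_set K) C \<and> closedin (top_of_set K) C}"

lemma clopens_subset: "C \<in> clopens K \<Longrightarrow> C \<subseteq> K"
  by (auto simp: clopens_def dest: openin_imp_subset)

lemma clopens_algebra: "algebra K (clopens K)"
  unfolding algebra_iff_Un
  by (auto simp: clopens_def openin_diff closedin_diff dest: openin_imp_subset)

lemma clopens_self [simp]: "K \<in> clopens K"
  by (simp add: clopens_def)

lemma clopens_vimage:
  assumes "continuous_on K f" "f ` K \<subseteq> L" "C \<in> clopens L"
  shows "K \<inter> f -` C \<in> clopens K"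
  using assms continuous_openin_preimage[of K f L C] continuous_closedin_preimage_gen[of K f L C]
  by (auto simp: clopens_def Pi_def image_subset_iff)

lemma clopens_Int: "open U \<Longrightarrow> closed U \<Longrightarrow> K \<inter> U \<in> clopens K"
  by (simp add: clopens_def closedin_closed_Int openin_open_Int)

lemma clopens_measurable:
  assumes "C \<in> clopens K"
  shows "C \<in> sets (restrict_space borel K)"
proof -
  obtain U where "open U" "C = K \<inter> U"
    using assms by (auto simp: clopens_def openin_open)
  then show ?thesis by (auto simp: sets_restrict_space)
qed

text \<open>
  Only the values on clopen sets matter for additivity, but all values are required to lie in \<open>[0,1]\<close>.
  In this way the contents form a closed subset of a power of \<open>[0,1]\<close>, and the function \<open>measure M\<close> of a
  probability measure on \<open>K\<close>, which vanishes on non-measurable sets, is itself a content.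
\<close>

definition content_on :: "'z::topological_space set \<Rightarrow> ('z set \<Rightarrow> real) \<Rightarrow> bool" where
  "content_on K \<mu> \<longleftrightarrow> (\<forall>C. 0 \<le> \<mu> C \<and> \<mu> C \<le> 1) \<and> \<mu> K = 1 \<and>
     (\<forall>A\<in>clopens K. \<forall>B\<in>clopens K. A \<inter> B = {} \<longrightarrow> \<mu> (A \<union> B) = \<mu> A + \<mu> B)"

lemma content_on_measure:
  assumes "prob_space M" "clopens K \<subseteq> sets M" "measure M K = 1"
  shows "content_on K (measure M)"
proof -
  interpret prob_space M by fact
  show ?thesis
    unfolding content_on_def using assms
    by (auto intro!: finite_measure_Union measure_nonneg)
qed

text \<open>
  Clopen subsets of \<open>K\<close> are compact, so a decreasing sequence of them with empty intersection is
  eventually empty. Hence finite additivity already gives continuity at the empty set, and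
  Caratheodory's theorem applies.
\<close>

lemma content_on_extension:
  fixes K :: "'z::topological_space set" and \<B> :: "'z set set"
  assumes K: "compact K" and closedK: "closed K" and \<B>: "clopen_basis \<B>" and \<mu>: "content_on K \<mu>"
  shows "\<exists>M. borel_prob_measure K M \<and> (\<forall>C\<in>clopens K. measure M C = \<mu> C)"
proof -
  interpret algebra K "clopens K" by (rule clopens_algebra)
  have nonneg: "0 \<le> \<mu> C" for C
    using \<mu> by (simp add: content_on_def)
  have add: "\<mu> (A \<union> B) = \<mu> A + \<mu> B"
    if "A \<in> clopens K" "B \<in> clopens K" "A \<inter> B = {}" for A B
    using \<mu> that by (simp add: content_on_def)
  have \<mu>_empty: "\<mu> {} = 0"
    using add[of "{}" "{}"] by simp
  have "\<exists>m. (\<forall>s\<in>clopens K. m s = ennreal (\<mu> s)) \<and> measure_space K (sigma_sets K (clopens K)) m"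
  proof (rule caratheodory_empty_continuous)
    show "positive (clopens K) (\<lambda>C. ennreal (\<mu> C))"
      by (simp add: positive_def \<mu>_empty)
    show "additive (clopens K) (\<lambda>C. ennreal (\<mu> C))"
      by (simp add: additive_def add nonneg ennreal_plus[symmetric] del: ennreal_plus)
    fix A :: "nat \<Rightarrow> 'z set"
    assume A: "range A \<subseteq> clopens K" "decseq A" "(\<Inter>i. A i) = {}"
    have "compact (A n)" "closed (A n)" for n
      using A(1) K closedin_compact[of K "A n"] closedin_closed_trans[of K "A n"] closedK
      by (auto simp: clopens_def)
    then obtain n where "A n = {}"
      using compact_nested[of A] A(2,3) by blast
    then have "A m = {}" if "n \<le> m" for m
      using decseqD[OF A(2) that] by auto
    then show "(\<lambda>i. ennreal (\<mu> (A i))) \<longlonglongrightarrow> 0"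
      by (intro tendsto_eventually) (auto simp: eventually_sequentially \<mu>_empty intro!: exI[of _ n])
  qed simp
  then obtain m where m: "\<And>s. s \<in> clopens K \<Longrightarrow> m s = ennreal (\<mu> s)"
      "measure_space K (sigma_sets K (clopens K)) m"
    by auto
  define M where "M = measure_of K (clopens K) m"
  have sub: "clopens K \<subseteq> Pow K" by (auto dest: clopens_subset)
  have sets_M: "sets M = sigma_sets K (clopens K)" and space_M: "space M = K"
    using sub by (auto simp: M_def)
  have em: "emeasure M C = ennreal (\<mu> C)" if "C \<in> clopens K" for C
    using that m emeasure_measure_of_sigma[of K "sigma_sets K (clopens K)" m C]
    unfolding M_def
    by (subst emeasure_measure_of[OF refl sub])
       (auto simp: measure_space_def sets_M[unfolded M_def] sigma_sets.Basic)
  have "sets M = sets (restrict_space borel K)"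
  proof
    have eq: "sets (restrict_space borel K) = sigma_sets K ((\<inter>) K ` \<B>)"
      using \<B> borel_closed[OF closedK] by (rule sets_restrict_borel_eq_sigma)
    have "(\<inter>) K ` \<B> \<subseteq> clopens K"
      using \<B> by (auto simp: clopen_basis_def topological_basis_open intro!: clopens_Int)
    then show "sets (restrict_space borel K) \<subseteq> sets M"
      unfolding eq sets_M by (rule sigma_sets_mono')
    show "sets M \<subseteq> sets (restrict_space borel K)"
      unfolding sets_M using clopens_measurable
      by (intro sets.sigma_sets_subset') (auto simp: sets_restrict_space)
  qed
  moreover have "prob_space M"
    by (rule prob_spaceI) (use em[of K] \<mu> in \<open>simp add: space_M content_on_def\<close>)
  ultimately show ?thesis
    using em nonneg by (auto simp: borel_prob_measure_def measure_def intro!: exI[of _ M])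
qed

text \<open>
  Tychonoff's theorem; this is the counterpart of weak-* compactness of the set of probability measures.
\<close>

lemma compact_contents: "compact {\<mu>. content_on K \<mu>}"
proof -
  have c [continuous_intros]: "continuous_on UNIV (\<lambda>\<mu>::_ \<Rightarrow> real. \<mu> C)" for C
    by simp
  have "compact (Pi\<^sub>E UNIV (\<lambda>_ :: 'a set. {0..1::real}))"
    by (rule compact_PiE_UNIV) simp
  moreover have "closed {\<mu>. content_on K \<mu>}"
    unfolding content_on_def Ball_def
    by (intro closed_Collect_conj closed_Collect_all closed_Collect_imp closed_Collect_le
          closed_Collect_eq open_Collect_const continuous_intros)
  ultimately have "compact (Pi\<^sub>E UNIV (\<lambda>_ :: 'a set. {0..1::real}) \<inter> {\<mu>. content_on K \<mu>})"
    by (rule compact_Int_closed)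
  also have "\<dots> = {\<mu>. content_on K \<mu>}"
    by (auto simp: content_on_def)
  finally show ?thesis .
qed

section \<open>Invariant lifts of a measure\<close>

lemma closed_eval_eq: "closed {\<mu>::'z set \<Rightarrow> real. \<mu> C = c}"
  by (intro closed_Collect_eq continuous_intros continuous_on_product_coordinates)

text \<open>
  By compactness it suffices to prescribe the values on the preimages of finitely many measurable sets.
  These generate a finite partition of the base; choosing one point of \<open>K\<close> over each of its cells gives a
  map \<open>g\<close> with finite range along which \<open>\<nu>\<close> can be pushed forward.
\<close>

lemma lift_content_exists:
  fixes K :: "'z::topological_space set"
  assumes \<nu>: "prob_space \<nu>" and image: "\<psi> ` K \<in> sets \<nu>" "measure \<nu> (\<psi> ` K) = 1"
  shows "\<exists>\<mu>. content_on K \<mu> \<and> (\<forall>B\<in>sets \<nu>. \<mu> (K \<inter> \<psi> -` B) = measure \<nu> B)"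
proof -
  interpret prob_space \<nu> by fact
  have "{\<mu>. content_on K \<mu>} \<inter> (\<Inter>B\<in>sets \<nu>. {\<mu>. \<mu> (K \<inter> \<psi> -` B) = measure \<nu> B}) \<noteq> {}"
  proof (rule compact_imp_fip_image[OF compact_contents closed_eval_eq])
    fix \<D> assume \<D>: "finite \<D>" "\<D> \<subseteq> sets \<nu>"
    \<comment> \<open>\<open>sig y\<close> names the cell of the partition that contains \<open>y\<close>; \<open>pt\<close> picks a point over each cell
      that meets the image of \<open>K\<close>.\<close>
    define sig where "sig y = {D\<in>\<D>. y \<in> D}" for y
    define pt where "pt E = (SOME x. x \<in> K \<and> sig (\<psi> x) = E)" for E
    define g where "g = pt \<circ> sig"
    have g: "g y \<in> K" "sig (\<psi> (g y)) = sig y" if "y \<in> \<psi> ` K" for y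
    proof -
      have "\<exists>x. x \<in> K \<and> sig (\<psi> x) = sig y"
        using that by auto
      from someI_ex[OF this] show "g y \<in> K" "sig (\<psi> (g y)) = sig y"
        by (auto simp: g_def pt_def)
    qed
    have "sig \<in> measurable \<nu> (count_space (Pow \<D>))"
    proof (subst measurable_count_space_eq2)
      have "sig -` {E} \<inter> space \<nu> \<in> sets \<nu>" if "E \<subseteq> \<D>" for E
      proof -
        have "sig -` {E} \<inter> space \<nu> = {y \<in> space \<nu>. \<forall>D\<in>\<D>. y \<in> D \<longleftrightarrow> D \<in> E}"
        proof -
          have "sig y = E \<longleftrightarrow> (\<forall>D\<in>\<D>. y \<in> D \<longleftrightarrow> D \<in> E)" for y
            using that unfolding sig_def by blast
          then show ?thesis by auto
        qed
        also have "\<dots> \<in> sets \<nu>"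
        proof (rule sets.sets_Collect_finite_All[OF _ \<D>(1)])
          fix D assume "D \<in> \<D>"
          then have "D \<in> sets \<nu>" using \<D> by auto
          then show "{y \<in> space \<nu>. (y \<in> D) = (D \<in> E)} \<in> sets \<nu>"
            by measurable
        qed
        finally show ?thesis .
      qed
      then show "sig \<in> space \<nu> \<rightarrow> Pow \<D> \<and> (\<forall>a\<in>Pow \<D>. sig -` {a} \<inter> space \<nu> \<in> sets \<nu>)"
        by (auto simp: sig_def)
    qed (use \<D> in auto)
    then have meas: "g \<in> measurable \<nu> (count_space UNIV)"
      unfolding g_def by (rule measurable_comp) simp
    define N where "N = distr \<nu> (count_space UNIV) g"
    have N: "measure N C = prob (g -` C \<inter> space \<nu>)" for C
      unfolding N_def by (rule measure_distr[OF meas]) simp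
    have AE: "AE y in \<nu>. y \<in> \<psi> ` K"
      using image(2) by (rule AE_prob_1)
    have "measure N K = 1"
    proof -
      have "prob (\<psi> ` K) \<le> prob (g -` K \<inter> space \<nu>)"
      proof (rule finite_measure_mono)
        show "\<psi> ` K \<subseteq> g -` K \<inter> space \<nu>"
          using g(1) sets.sets_into_space[OF image(1)] by auto
      qed (use measurable_sets[OF meas] in auto)
      then show ?thesis
        using image(2) prob_le_1 by (simp add: N antisym)
    qed
    moreover have "prob_space N"
      unfolding N_def using meas by (rule prob_space_distr)
    moreover have "clopens K \<subseteq> sets N" by (simp add: N_def)
    ultimately have "content_on K (measure N)"
      by (intro content_on_measure)
    moreover have "measure N (K \<inter> \<psi> -` D) = measure \<nu> D" if "D \<in> \<D>" for D
      unfolding N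
    proof (rule finite_measure_eq_AE)
      show "AE y in \<nu>. (y \<in> g -` (K \<inter> \<psi> -` D) \<inter> space \<nu>) = (y \<in> D)"
        using AE AE_space
      proof eventually_elim
        case (elim y)
        have "sig (\<psi> (g y)) = sig y" "g y \<in> K"
          using g elim by auto
        then show ?case
          using \<open>D \<in> \<D>\<close> elim by (auto simp: sig_def)
      qed
    qed (use measurable_sets[OF meas] \<D> that in \<open>auto simp del: vimage_Int\<close>)
    ultimately show "{\<mu>. content_on K \<mu>} \<inter>
        (\<Inter>B\<in>\<D>. {\<mu>. \<mu> (K \<inter> \<psi> -` B) = measure \<nu> B}) \<noteq> {}"
      by (auto intro!: exI[of _ "measure N"])
  qed
  then show ?thesis by auto
qed

text \<open>
  Contents that are invariant under \<open>T\<close> and lie over \<open>\<nu>\<close>. The second condition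
  is imposed for all measurable sets of the base because averaging along orbits involves the preimages of a given
  set under the base map.
\<close>

definition lift_contents ::
  "'z::topological_space set \<Rightarrow> ('z \<Rightarrow> 'z) \<Rightarrow> ('z \<Rightarrow> 'y) \<Rightarrow> 'y measure \<Rightarrow> ('z set \<Rightarrow> real) set" where
  "lift_contents K T \<psi> \<nu> =
     {\<mu>. content_on K \<mu> \<and> (\<forall>B\<in>sets \<nu>. \<mu> (K \<inter> \<psi> -` B) = measure \<nu> B) \<and>
        (\<forall>C\<in>clopens K. \<mu> (K \<inter> T -` C) = \<mu> C)}"

lemma compact_lift_contents: "compact (lift_contents K T \<psi> \<nu>)"
proof -
  have "lift_contents K T \<psi> \<nu> = {\<mu>. content_on K \<mu>} \<inter>
      ((\<Inter>B\<in>sets \<nu>. {\<mu>. \<mu> (K \<inter> \<psi> -` B) = measure \<nu> B}) \<inter>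
       (\<Inter>C\<in>clopens K. {\<mu>. \<mu> (K \<inter> T -` C) = \<mu> C}))"
    by (auto simp: lift_contents_def)
  also have "compact \<dots>"
    by (intro compact_Int_closed compact_contents closed_Int closed_INT ballI closed_eval_eq
        closed_Collect_eq continuous_on_product_coordinates)
  finally show ?thesis .
qed

lemma measure_invariant:
  assumes "invariant_measure T M" "B \<in> sets M"
  shows "measure M (T -` B \<inter> space M) = measure M B"
  using assms measure_distr[of T M M B] by (simp add: invariant_measure_def)

text \<open>
  The Krylov-Bogolyubov argument: averages of a lift along its orbit are again lifts, because \<open>\<nu>\<close> is
  invariant, and they are invariant up to an error of order \<open>1/n\<close>. Compactness yields a limit.
\<close>

lemma lift_contents_nonempty:
  fixes K :: "'z::topological_space set"
  assumes \<nu>: "prob_space \<nu>" "invariant_measure S \<nu>"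
    and image: "\<psi> ` K \<in> sets \<nu>" "measure \<nu> (\<psi> ` K) = 1"
    and T: "continuous_on K T" "T ` K \<subseteq> K"
    and equi: "\<And>x. x \<in> K \<Longrightarrow> \<psi> (T x) = S (\<psi> x)"
  shows "lift_contents K T \<psi> \<nu> \<noteq> {}"
proof -
  have into: "\<psi> ` K \<subseteq> space \<nu>"
    using sets.sets_into_space[OF image(1)] .
  define L where "L = {\<mu>. content_on K \<mu>} \<inter> (\<Inter>B\<in>sets \<nu>. {\<mu>. \<mu> (K \<inter> \<psi> -` B) = measure \<nu> B})"
  obtain \<mu> where \<mu>: "\<mu> \<in> L"
    using lift_content_exists[OF \<nu>(1) image] by (auto simp: L_def)
  have \<mu>01: "0 \<le> \<mu> C" "\<mu> C \<le> 1" for C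
    using \<mu> by (auto simp: L_def content_on_def)
  define \<tau> where "\<tau> C = K \<inter> T -` C" for C
  have \<tau>_clopen: "(\<tau> ^^ k) C \<in> clopens K" if "C \<in> clopens K" for C k
    using that by (induction k) (auto simp: \<tau>_def intro: clopens_vimage[OF T])
  have \<tau>_K: "(\<tau> ^^ k) K = K" for k
    using T(2) by (induction k) (auto simp: \<tau>_def)
  have \<tau>_Un: "(\<tau> ^^ k) (A \<union> B) = (\<tau> ^^ k) A \<union> (\<tau> ^^ k) B"
    and \<tau>_Int: "A \<inter> B = {} \<Longrightarrow> (\<tau> ^^ k) A \<inter> (\<tau> ^^ k) B = {}" for k A B
    by (induction k) (auto simp: \<tau>_def)
  have \<tau>_lift: "\<mu> ((\<tau> ^^ k) (K \<inter> \<psi> -` B)) = measure \<nu> B" if "B \<in> sets \<nu>" for k B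
    using that
  proof (induction k arbitrary: B)
    case 0
    then show ?case using \<mu> by (simp add: L_def)
  next
    case (Suc k)
    have "\<tau> (K \<inter> \<psi> -` B) = K \<inter> \<psi> -` (S -` B \<inter> space \<nu>)"
      using T(2) into equi by (auto simp: \<tau>_def)
    moreover have "S -` B \<inter> space \<nu> \<in> sets \<nu>"
      using \<nu>(2) Suc.prems by (auto simp: invariant_measure_def)
    ultimately show ?case
      using Suc.IH[of "S -` B \<inter> space \<nu>"] Suc.prems measure_invariant[OF \<nu>(2), of B]
      by (simp add: funpow_Suc_right del: funpow.simps vimage_Int)
  qed
  define avg where "avg n C = (\<Sum>k<Suc n. \<mu> ((\<tau> ^^ k) C)) / real (Suc n)" for n C
  have avg_L: "avg n \<in> L" for n
  proof -
    have "avg n C \<le> 1" for C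
    proof -
      have "(\<Sum>k<Suc n. \<mu> ((\<tau> ^^ k) C)) \<le> (\<Sum>k<Suc n. 1)"
        by (rule sum_mono) (rule \<mu>01)
      then show ?thesis by (simp add: avg_def)
    qed
    moreover have "0 \<le> avg n C" for C
      unfolding avg_def by (intro divide_nonneg_nonneg sum_nonneg \<mu>01) simp
    moreover have "avg n K = 1"
      using \<mu> by (simp add: avg_def \<tau>_K L_def content_on_def)
    moreover have "avg n (A \<union> B) = avg n A + avg n B"
      if "A \<in> clopens K" "B \<in> clopens K" "A \<inter> B = {}" for A B
    proof -
      have "\<mu> ((\<tau> ^^ k) (A \<union> B)) = \<mu> ((\<tau> ^^ k) A) + \<mu> ((\<tau> ^^ k) B)" for k
        unfolding \<tau>_Un using \<mu> \<tau>_clopen that \<tau>_Int by (auto simp: L_def content_on_def)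
      then show ?thesis
        by (simp add: avg_def sum.distrib add_divide_distrib del: sum.lessThan_Suc)
    qed
    moreover have "avg n (K \<inter> \<psi> -` B) = measure \<nu> B" if "B \<in> sets \<nu>" for B
      by (simp add: avg_def \<tau>_lift[OF that] del: sum.lessThan_Suc)
    ultimately show ?thesis
      by (auto simp: L_def content_on_def)
  qed
  have avg_inv: "\<bar>avg n (\<tau> C) - avg n C\<bar> \<le> 1 / real (Suc n)" for n C
  proof -
    have "avg n (\<tau> C) - avg n C =
        (\<Sum>k<Suc n. \<mu> ((\<tau> ^^ Suc k) C) - \<mu> ((\<tau> ^^ k) C)) / real (Suc n)"
      unfolding avg_def sum_subtractf diff_divide_distrib funpow_Suc_right o_apply ..
    also have "\<dots> = (\<mu> ((\<tau> ^^ Suc n) C) - \<mu> ((\<tau> ^^ 0) C)) / real (Suc n)"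
      by (subst sum_lessThan_telescope) (rule refl)
    finally have "\<bar>avg n (\<tau> C) - avg n C\<bar> = \<bar>\<mu> ((\<tau> ^^ Suc n) C) - \<mu> ((\<tau> ^^ 0) C)\<bar> / real (Suc n)"
      by simp
    also have "\<dots> \<le> 1 / real (Suc n)"
      using \<mu>01[of "(\<tau> ^^ Suc n) C"] \<mu>01[of "(\<tau> ^^ 0) C"]
      by (intro divide_right_mono) linarith+
    finally show ?thesis .
  qed
  have "compact L"
    unfolding L_def
    by (intro compact_Int_closed compact_contents closed_INT ballI closed_eval_eq)
  then have "L \<inter> (\<Inter>n. {\<mu>. \<forall>C\<in>clopens K. \<bar>\<mu> (\<tau> C) - \<mu> C\<bar> \<le> 1 / real (Suc n)}) \<noteq> {}"
  proof (rule compact_imp_fip_image)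
    show "closed {\<mu>. \<forall>C\<in>clopens K. \<bar>\<mu> (\<tau> C) - \<mu> C\<bar> \<le> 1 / real (Suc n)}" for n
      unfolding Ball_def
      by (intro closed_Collect_all closed_Collect_imp closed_Collect_le open_Collect_const
          continuous_intros continuous_on_product_coordinates)
    fix I :: "nat set" assume I: "finite I"
    have "avg (Max (insert 0 I)) \<in> {\<mu>. \<forall>C\<in>clopens K. \<bar>\<mu> (\<tau> C) - \<mu> C\<bar> \<le> 1 / real (Suc n)}"
      if "n \<in> I" for n
    proof -
      have "1 / real (Suc (Max (insert 0 I))) \<le> 1 / real (Suc n)"
        using I that by (intro divide_left_mono) auto
      then show ?thesis
        using avg_inv order_trans by blast
    qed
    then show "L \<inter> (\<Inter>n\<in>I. {\<mu>. \<forall>C\<in>clopens K. \<bar>\<mu> (\<tau> C) - \<mu> C\<bar> \<le> 1 / real (Suc n)}) \<noteq> {}"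
      using avg_L by blast
  qed
  then obtain \<kappa> where \<kappa>: "\<kappa> \<in> L"
      "\<And>n C. C \<in> clopens K \<Longrightarrow> \<bar>\<kappa> (\<tau> C) - \<kappa> C\<bar> \<le> 1 / real (Suc n)"
    by auto
  have "\<kappa> (\<tau> C) = \<kappa> C" if "C \<in> clopens K" for C
  proof (rule ccontr)
    assume "\<kappa> (\<tau> C) \<noteq> \<kappa> C"
    then obtain n where "inverse (real (Suc n)) < \<bar>\<kappa> (\<tau> C) - \<kappa> C\<bar>"
      using reals_Archimedean[of "\<bar>\<kappa> (\<tau> C) - \<kappa> C\<bar>"] by auto
    then show False
      using \<kappa>(2)[OF that, of n] by (simp add: inverse_eq_divide)
  qed
  then have "\<kappa> \<in> lift_contents K T \<psi> \<nu>"
    using \<kappa>(1) by (auto simp: lift_contents_def L_def \<tau>_def)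
  then show ?thesis by blast
qed

section \<open>Extremality\<close>

text \<open>
  A continuous functional on contents that is strictly convex in the values on the sets \<open>K \<inter> U\<close> with \<open>U\<close> in
  the basis. A content that maximises it over a convex set is therefore not a proper convex combination of two
  members that differ on one of these sets.
\<close>

definition energy :: "'z set set \<Rightarrow> 'z set \<Rightarrow> ('z set \<Rightarrow> real) \<Rightarrow> real" where
  "energy \<B> K \<mu> = (\<Sum>n. (1/2) ^ n * (\<mu> (K \<inter> from_nat_into \<B> n))\<^sup>2)"

lemma power2_le_one: "0 \<le> a \<Longrightarrow> a \<le> 1 \<Longrightarrow> a\<^sup>2 \<le> (1::real)"
  by (simp add: power_le_one)

lemma summable_energy:
  assumes "\<And>C. 0 \<le> \<mu> C \<and> \<mu> C \<le> (1::real)"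
  shows "summable (\<lambda>n. (1/2::real) ^ n * (\<mu> (K \<inter> from_nat_into \<B> n))\<^sup>2)"
  using assms
  by (intro summable_comparison_test'[OF summable_geometric[of "1/2::real"]])
     (auto simp: norm_mult intro!: mult_left_le power2_le_one)

lemma continuous_on_energy: "continuous_on {\<mu>. content_on K \<mu>} (energy \<B> K)"
proof -
  have "uniform_limit {\<mu>. content_on K \<mu>}
      (\<lambda>m \<mu>. \<Sum>n<m. (1/2) ^ n * (\<mu> (K \<inter> from_nat_into \<B> n))\<^sup>2)
      (\<lambda>\<mu>. \<Sum>n. (1/2) ^ n * (\<mu> (K \<inter> from_nat_into \<B> n))\<^sup>2) sequentially"
    by (rule Weierstrass_m_test[where M="\<lambda>n. (1/2) ^ n"])
       (auto simp: content_on_def norm_mult intro!: mult_left_le power2_le_one)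
  then show ?thesis
    unfolding energy_def[abs_def]
    by (rule uniform_limit_theorem[rotated])
       (auto intro!: always_eventually continuous_intros
          continuous_on_subset[OF continuous_on_product_coordinates])
qed

text \<open>
  The weighted sum of the defects \<open>t a\<^sup>2 + (1-t) b\<^sup>2 - (t a + (1-t) b)\<^sup>2 = t (1-t) (a-b)\<^sup>2\<close> is nonpositive
  by maximality, so every single defect vanishes.
\<close>

lemma energy_strictly_convex:
  assumes \<B>: "countable \<B>" "\<B> \<noteq> {}" and t: "0 < t" "t < (1::real)"
    and \<mu>1: "\<And>C. 0 \<le> \<mu>1 C \<and> \<mu>1 C \<le> 1" and \<mu>2: "\<And>C. 0 \<le> \<mu>2 C \<and> \<mu>2 C \<le> 1"
    and eq: "\<And>U. U \<in> \<B> \<Longrightarrow> \<mu> (K \<inter> U) = t * \<mu>1 (K \<inter> U) + (1 - t) * \<mu>2 (K \<inter> U)"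
    and le: "energy \<B> K \<mu>1 \<le> energy \<B> K \<mu>" "energy \<B> K \<mu>2 \<le> energy \<B> K \<mu>"
    and U: "U \<in> \<B>"
  shows "\<mu>1 (K \<inter> U) = \<mu>2 (K \<inter> U)"
proof -
  define a where "a n = \<mu>1 (K \<inter> from_nat_into \<B> n)" for n
  define b where "b n = \<mu>2 (K \<inter> from_nat_into \<B> n)" for n
  have ab: "\<mu> (K \<inter> from_nat_into \<B> n) = t * a n + (1 - t) * b n" for n
    using eq from_nat_into[OF \<B>(2)] by (simp add: a_def b_def)
  have sa: "summable (\<lambda>n. (1/2::real) ^ n * (a n)\<^sup>2)" and sb: "summable (\<lambda>n. (1/2::real) ^ n * (b n)\<^sup>2)"
    unfolding a_def b_def using \<mu>1 \<mu>2 by (auto intro!: summable_energy)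
  define c where "c n = (1/2::real) ^ n * (t * (1 - t) * (a n - b n)\<^sup>2)" for n
  have c0: "0 \<le> c n" for n
    using t by (simp add: c_def)
  have split: "(1/2::real) ^ n * (t * a n + (1 - t) * b n)\<^sup>2 =
      t * ((1/2) ^ n * (a n)\<^sup>2) + (1 - t) * ((1/2) ^ n * (b n)\<^sup>2) - c n" for n
    unfolding c_def by (simp add: algebra_simps power2_eq_square)
  have sab: "summable (\<lambda>n. (1/2::real) ^ n * (t * a n + (1 - t) * b n)\<^sup>2)"
  proof (rule summable_comparison_test')
    show "summable (\<lambda>n. t * ((1/2) ^ n * (a n)\<^sup>2) + (1 - t) * ((1/2) ^ n * (b n)\<^sup>2))"
      by (intro summable_add summable_mult sa sb)
    show "norm ((1/2::real) ^ n * (t * a n + (1 - t) * b n)\<^sup>2) \<le>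
        t * ((1/2) ^ n * (a n)\<^sup>2) + (1 - t) * ((1/2) ^ n * (b n)\<^sup>2)" if "n \<ge> 0" for n
    proof -
      have "norm ((1/2::real) ^ n * (t * a n + (1 - t) * b n)\<^sup>2) =
          (1/2::real) ^ n * (t * a n + (1 - t) * b n)\<^sup>2"
        by (simp add: norm_mult)
      then show ?thesis
        using split[of n] c0[of n] by linarith
    qed
  qed
  have c_eq: "c n = t * ((1/2) ^ n * (a n)\<^sup>2) + (1 - t) * ((1/2) ^ n * (b n)\<^sup>2)
      - (1/2::real) ^ n * (t * a n + (1 - t) * b n)\<^sup>2" for n
    using split[of n] by linarith
  have sc: "summable c" and c_sum: "suminf c = t * energy \<B> K \<mu>1 + (1 - t) * energy \<B> K \<mu>2 - energy \<B> K \<mu>"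
    unfolding c_eq[abs_def] energy_def ab a_def[symmetric] b_def[symmetric]
    using sa sb sab
    by (simp_all add: suminf_diff[symmetric] suminf_add[symmetric] suminf_mult[symmetric]
        summable_diff summable_add summable_mult)
  have "t * energy \<B> K \<mu>1 + (1 - t) * energy \<B> K \<mu>2 \<le> t * energy \<B> K \<mu> + (1 - t) * energy \<B> K \<mu>"
    using le t by (intro add_mono mult_left_mono) auto
  then have "suminf c \<le> 0"
    unfolding c_sum by (simp add: algebra_simps)
  then have "suminf c = 0"
    using suminf_nonneg[OF sc c0] by simp
  then have "c n = 0" for n
    using suminf_eq_zero_iff[OF sc c0] by auto
  then have "a n = b n" for n
    using t by (auto simp: c_def)
  moreover obtain n where "from_nat_into \<B> n = U"
    using from_nat_into_surj[OF \<B>(1) U] by auto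
  ultimately show ?thesis
    unfolding a_def b_def by metis
qed

text \<open>
  Absolute continuity and ergodicity force \<open>N\<close> and \<open>\<nu>\<close> to agree on invariant sets. The difference
  \<open>d = N - \<nu>\<close> attains its maximum, by the Hahn decomposition, and the sets where it does are
  closed under unions, preimages and monotone limits. So there is an invariant set among
  them, the limit superior of the preimages of a given one, and the maximum of \<open>d\<close> is \<open>0\<close>.
\<close>

lemma ergodic_absolutely_continuous_eq:
  assumes erg: "ergodic_measure S \<nu>" and \<nu>: "prob_space \<nu>"
    and N: "prob_space N" "sets N = sets \<nu>" "invariant_measure S N"
    and ac: "\<And>B. B \<in> sets \<nu> \<Longrightarrow> measure \<nu> B = 0 \<Longrightarrow> measure N B = 0"
  shows "N = \<nu>"
proof -
  interpret \<nu>: prob_space \<nu> by fact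
  interpret N: prob_space N by fact
  note [simp] = N(2)
  have space: "space N = space \<nu>"
    using N(2) by (rule sets_eq_imp_space_eq)
  have inv: "invariant_measure S \<nu>"
    using erg by (simp add: ergodic_measure_def)
  define d where "d B = measure N B - measure \<nu> B" for B
  have d_add: "d (A \<union> B) = d A + d B" if "A \<in> sets \<nu>" "B \<in> sets \<nu>" "A \<inter> B = {}" for A B
    using that by (simp add: d_def N.finite_measure_Union \<nu>.finite_measure_Union)
  obtain E where E: "E \<in> sets \<nu>" "\<And>B. B \<in> sets \<nu> \<Longrightarrow> B \<subseteq> E \<Longrightarrow> 0 \<le> d B"
      "\<And>B. B \<in> sets \<nu> \<Longrightarrow> B \<inter> E = {} \<Longrightarrow> d B \<le> 0"
    using finite_unsigned_Hahn_decomposition[of N \<nu>] N.finite_measure_axioms \<nu>.finite_measure_axioms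
    by (auto simp: d_def N.emeasure_eq_measure \<nu>.emeasure_eq_measure)
  have E_max: "d B \<le> d E" if "B \<in> sets \<nu>" for B
  proof -
    have "d B = d (B \<inter> E) + d (B - E)"
      using that E(1) d_add[of "B \<inter> E" "B - E"] by (simp add: Int_Diff_disjoint Int_Diff_Un)
    moreover have "d E = d (B \<inter> E) + d (E - B)"
      using that E(1) d_add[of "E \<inter> B" "E - B"]
      by (simp add: Int_Diff_disjoint Int_Diff_Un Int_commute[of B E])
    moreover have "d (B - E) \<le> 0" "0 \<le> d (E - B)"
      using that E(1) by (auto intro!: E(2,3))
    ultimately show ?thesis by linarith
  qed
  define maxi where "maxi B \<longleftrightarrow> B \<in> sets \<nu> \<and> d B = d E" for B
  have maxi_Un: "maxi (A \<union> B)" if "maxi A" "maxi B" for A B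
  proof -
    have AB: "A \<in> sets \<nu>" "B \<in> sets \<nu>" "d A = d E" "d B = d E"
      using that by (auto simp: maxi_def)
    have "A \<union> (B - A) = A \<union> B" "(A \<inter> B) \<union> (B - A) = B"
      by auto
    then have "d (A \<union> B) = d A + d (B - A)" "d B = d (A \<inter> B) + d (B - A)"
      using AB d_add[of A "B - A"] d_add[of "A \<inter> B" "B - A"] by auto
    then show ?thesis
      using AB E_max[of "A \<union> B"] E_max[of "A \<inter> B"] by (auto simp: maxi_def)
  qed
  define pre where "pre B = S -` B \<inter> space \<nu>" for B
  have maxi_pre: "maxi (pre B)" if "maxi B" for B
    using that measure_invariant[OF inv, of B] measure_invariant[OF N(3), of B] inv
    by (auto simp: maxi_def pre_def d_def space invariant_measure_def)
  have maxi_inc: "maxi (\<Union>n. U n)" if "incseq U" "\<And>n. maxi (U n)" for U :: "nat \<Rightarrow> _"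
  proof -
    have r: "range U \<subseteq> sets \<nu>" "\<And>n. d (U n) = d E" using that by (auto simp: maxi_def)
    have "(\<lambda>n. d (U n)) \<longlonglongrightarrow> d (\<Union>n. U n)"
      unfolding d_def using r that(1)
      by (intro tendsto_diff N.finite_Lim_measure_incseq \<nu>.finite_Lim_measure_incseq) auto
    then have "d (\<Union>n. U n) = d E"
      by (simp add: r LIMSEQ_const_iff)
    then show ?thesis using r by (auto simp: maxi_def)
  qed
  have maxi_dec: "maxi (\<Inter>n. U n)" if "decseq U" "\<And>n. maxi (U n)" for U :: "nat \<Rightarrow> _"
  proof -
    have r: "range U \<subseteq> sets \<nu>" "\<And>n. d (U n) = d E" using that by (auto simp: maxi_def)
    have "(\<lambda>n. d (U n)) \<longlonglongrightarrow> d (\<Inter>n. U n)"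
      unfolding d_def using r that(1)
      by (intro tendsto_diff N.finite_Lim_measure_decseq \<nu>.finite_Lim_measure_decseq) auto
    then have "d (\<Inter>n. U n) = d E"
      by (simp add: r LIMSEQ_const_iff)
    then show ?thesis using r by (auto simp: maxi_def)
  qed
  have maxi_pow: "maxi ((pre ^^ k) B)" if "maxi B" for k B
    using that by (induction k) (auto intro: maxi_pre)
  \<comment> \<open>The preimage of \<open>V\<close> is contained in \<open>V\<close>, so the iterated preimages decrease, and their intersection \<open>W\<close>
    is invariant.\<close>
  define V where "V = (\<Union>n. \<Union>k\<le>n. (pre ^^ k) E)"
  have "maxi (\<Union>k\<le>n. (pre ^^ k) E)" for n
  proof (induction n)
    case 0
    then show ?case by (simp add: maxi_def E)
  next
    case (Suc n)
    have "maxi E" by (simp add: maxi_def E)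
    then show ?case
      using maxi_Un[OF maxi_pow Suc, of E "Suc n"] by (simp add: atMost_Suc del: funpow.simps)
  qed
  then have "maxi V"
    unfolding V_def by (intro maxi_inc) (auto simp: incseq_def intro: order_trans)
  have "pre V \<subseteq> V"
  proof
    fix x assume "x \<in> pre V"
    then obtain k where "x \<in> pre ((pre ^^ k) E)"
      by (auto simp: V_def pre_def)
    then have "x \<in> (pre ^^ Suc k) E" by simp
    then show "x \<in> V" unfolding V_def by blast
  qed
  have pre_mono: "pre A \<subseteq> pre B" if "A \<subseteq> B" for A B
    using that by (auto simp: pre_def)
  define W where "W = (\<Inter>j. (pre ^^ j) V)"
  have dec: "decseq (\<lambda>j. (pre ^^ j) V)"
  proof (rule decseq_SucI)
    show "(pre ^^ Suc j) V \<subseteq> (pre ^^ j) V" for j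
      by (induction j) (use \<open>pre V \<subseteq> V\<close> pre_mono in auto)
  qed
  then have "maxi W"
    unfolding W_def using maxi_pow[OF \<open>maxi V\<close>] by (intro maxi_dec)
  have "pre W = W"
  proof -
    have "pre W = (\<Inter>j. (pre ^^ Suc j) V)"
      by (auto simp: W_def pre_def)
    also have "\<dots> = W"
      unfolding W_def using dec decseq_SucD[OF dec] by (blast dest: decseqD)
    finally show ?thesis .
  qed
  then have "S -` W \<inter> space \<nu> = W" "W \<in> sets \<nu>"
    using \<open>maxi W\<close> by (auto simp: pre_def maxi_def)
  then consider "measure \<nu> W = 0" | "measure \<nu> W = 1"
    using erg unfolding ergodic_measure_def by blast
  then have "d W = 0"
  proof cases
    case 1
    then show ?thesis using ac \<open>W \<in> sets \<nu>\<close> by (simp add: d_def)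
  next
    case 2
    then have "measure N (space \<nu> - W) = 0"
      using ac[of "space \<nu> - W"] \<nu>.prob_compl[of W] \<open>W \<in> sets \<nu>\<close> by simp
    then show ?thesis
      using 2 N.prob_compl[of W] \<open>W \<in> sets \<nu>\<close> by (simp add: d_def space)
  qed
  then have le: "d B \<le> 0" if "B \<in> sets \<nu>" for B
    using E_max[OF that] \<open>maxi W\<close> by (simp add: maxi_def)
  have "d B = 0" if "B \<in> sets \<nu>" for B
    using le[OF that] le[of "space \<nu> - B"] that N.prob_compl[of B] \<nu>.prob_compl[of B]
    by (auto simp: d_def space)
  then show ?thesis
    by (intro measure_eqI) (auto simp: d_def N.emeasure_eq_measure \<nu>.emeasure_eq_measure)
qed

section \<open>Ergodic lifts\<close>

text \<open>
  The image of the conditional measure is invariant and absolutely continuous with respect to \<open>\<nu>\<close>,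
  hence equal to \<open>\<nu>\<close> by ergodicity.
\<close>

lemma uniform_measure_invariant_lift:
  assumes M: "borel_prob_measure K M" "invariant_measure T M"
    and \<psi>: "\<psi> \<in> measurable M \<nu>" "distr M \<nu> \<psi> = \<nu>"
    and \<nu>: "prob_space \<nu>" "ergodic_measure S \<nu>"
    and equi: "\<And>x. x \<in> K \<Longrightarrow> \<psi> (T x) = S (\<psi> x)"
    and A: "A \<in> sets M" "T -` A \<inter> space M = A" "measure M A \<noteq> 0"
  shows "borel_prob_measure K (uniform_measure M A) \<and> invariant_measure T (uniform_measure M A) \<and>
         distr (uniform_measure M A) \<nu> \<psi> = \<nu>"
proof -
  interpret M: prob_space M using M by (simp add: borel_prob_measure_def)
  define N where "N = uniform_measure M A"
  have em: "emeasure M A \<noteq> 0" "emeasure M A \<noteq> \<infinity>"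
    using A(3) by (auto simp: M.emeasure_eq_measure)
  have sets_N [simp]: "sets N = sets M" and space_N [simp]: "space N = space M"
    by (simp_all add: N_def)
  have N: "prob_space N"
    unfolding N_def using em by (rule prob_space_uniform_measure)
  interpret N: prob_space N by fact
  have meas_N: "measure N B = measure M (A \<inter> B) / measure M A" if "B \<in> sets M" for B
    unfolding N_def using em that by simp
  have T: "T \<in> measurable M M"
    using M(2) by (simp add: invariant_measure_def)
  have T_N: "T \<in> measurable N N" and \<psi>_N: "\<psi> \<in> measurable N \<nu>"
    using T \<psi>(1) measurable_cong_sets[OF sets_N sets_N] measurable_cong_sets[OF sets_N refl, of \<nu>]
    by blast+
  have space_M: "space M = K"
    using M(1) by (rule space_borel_prob_measure)
  have inv_N: "invariant_measure T N"
    unfolding invariant_measure_def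
  proof (intro conjI T_N)
    show "distr N N T = N"
    proof (rule measure_eqI)
      fix B assume "B \<in> sets (distr N N T)"
      then have B: "B \<in> sets M" by simp
      then have TB: "T -` B \<inter> space M \<in> sets M"
        using T by auto
      have "A \<inter> (T -` B \<inter> space M) = T -` (A \<inter> B) \<inter> space M"
        using A(2) by auto
      then have "measure M (A \<inter> (T -` B \<inter> space M)) = measure M (A \<inter> B)"
        using measure_invariant[OF M(2), of "A \<inter> B"] A(1) B by auto
      then have "measure N (T -` B \<inter> space M) = measure N B"
        using meas_N B TB by simp
      then show "emeasure (distr N N T) B = emeasure N B"
        using B T_N by (simp add: emeasure_distr N.emeasure_eq_measure)
    qed simp
  qed
  have "distr N \<nu> \<psi> = \<nu>"
  proof (rule ergodic_absolutely_continuous_eq[OF \<nu>(2,1)])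
    show "prob_space (distr N \<nu> \<psi>)"
      using \<psi>_N by (rule N.prob_space_distr)
    have S: "S \<in> measurable \<nu> \<nu>"
      using \<nu>(2) by (simp add: ergodic_measure_def invariant_measure_def)
    have "distr (distr N \<nu> \<psi>) \<nu> S = distr N \<nu> (S \<circ> \<psi>)"
      using S \<psi>_N by (rule distr_distr)
    also have "\<dots> = distr N \<nu> (\<psi> \<circ> T)"
      using equi by (intro distr_cong) (auto simp: space_M)
    also have "\<dots> = distr (distr N N T) \<nu> \<psi>"
      using \<psi>_N T_N by (rule distr_distr[symmetric])
    also have "\<dots> = distr N \<nu> \<psi>"
      using inv_N by (simp add: invariant_measure_def)
    finally show "invariant_measure S (distr N \<nu> \<psi>)"
      using S by (simp add: invariant_measure_def cong: distr_cong)
    fix B assume B: "B \<in> sets \<nu>" "measure \<nu> B = 0"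
    have PB: "\<psi> -` B \<inter> space M \<in> sets M"
      using \<psi>(1) B(1) by auto
    have "measure M (\<psi> -` B \<inter> space M) = 0"
      using measure_distr[OF \<psi>(1) B(1)] B(2) \<psi>(2) by simp
    then have "measure M (A \<inter> (\<psi> -` B \<inter> space M)) = 0"
      using M.finite_measure_mono[OF Int_lower2[of A] PB]
        measure_nonneg[of M "A \<inter> (\<psi> -` B \<inter> space M)"] by linarith
    then show "measure (distr N \<nu> \<psi>) B = 0"
      using measure_distr[OF \<psi>_N B(1)] meas_N[OF PB] by simp
  qed simp
  then show ?thesis
    using M(1) N inv_N by (simp add: borel_prob_measure_def N_def)
qed

text \<open>
  An invariant lift \<open>M\<close> of maximal energy is ergodic: if \<open>A\<close> were invariant with \<open>0 < M A < 1\<close>, then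
  \<open>M\<close> would be a proper convex combination of its conditional measures on \<open>A\<close> and on the complement of \<open>A\<close>.
  Both are invariant lifts of \<open>\<nu>\<close>, so strict convexity of the energy would make them equal.
\<close>

theorem ergodic_lift:
  fixes K :: "'z::topological_space set" and Y :: "'y::topological_space set" and \<B> :: "'z set set"
    and \<C> :: "'y set set"
  assumes \<B>: "clopen_basis \<B>" and \<C>: "clopen_basis \<C>"
    and K: "compact K" "closed K" and Y: "Y \<in> sets borel"
    and T: "continuous_on K T" "T ` K \<subseteq> K"
    and \<psi>: "continuous_on K \<psi>" and equi: "\<And>x. x \<in> K \<Longrightarrow> \<psi> (T x) = S (\<psi> x)"
    and \<nu>: "borel_prob_measure Y \<nu>" "ergodic_measure S \<nu>"
    and image: "\<psi> ` K \<in> sets \<nu>" "measure \<nu> (\<psi> ` K) = 1"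
  shows "\<exists>M. borel_prob_measure K M \<and> ergodic_measure T M \<and> distr M \<nu> \<psi> = \<nu>"
proof -
  have \<nu>': "prob_space \<nu>" "invariant_measure S \<nu>" "sets \<nu> = sets (restrict_space borel Y)"
    using \<nu> by (auto simp: borel_prob_measure_def ergodic_measure_def)
  have space_\<nu>: "space \<nu> = Y"
    using \<nu>(1) by (rule space_borel_prob_measure)
  have into: "\<psi> ` K \<subseteq> Y"
    using sets.sets_into_space[OF image(1)] space_\<nu> by simp
  have \<B>': "countable \<B>" "\<B> \<noteq> {}" "\<And>U. U \<in> \<B> \<Longrightarrow> K \<inter> U \<in> clopens K"
  proof -
    show "countable \<B>" using \<B> by (simp add: clopen_basis_def)
    show "\<B> \<noteq> {}"
      using \<B> topological_basisE[of \<B> UNIV] by (auto simp: clopen_basis_def)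
    show "\<And>U. U \<in> \<B> \<Longrightarrow> K \<inter> U \<in> clopens K"
      using \<B> by (auto simp: clopen_basis_def topological_basis_open intro!: clopens_Int)
  qed
  have meas: "\<psi> \<in> measurable M \<nu>" "T \<in> measurable M M"
    and clopens_sets: "clopens K \<subseteq> sets M" if "borel_prob_measure K M" for M
  proof -
    show "\<psi> \<in> measurable M \<nu>"
      using that \<psi> into \<nu>'(3) by (rule measurable_borel_prob_measure)
    show "T \<in> measurable M M"
      using that T by (rule measurable_borel_prob_measure)
        (use that in \<open>simp add: borel_prob_measure_def\<close>)
    show "clopens K \<subseteq> sets M"
      using that clopens_measurable by (auto simp: borel_prob_measure_def)
  qed
  have in_lift: "measure M \<in> lift_contents K T \<psi> \<nu>"
    if M: "borel_prob_measure K M" "invariant_measure T M" "distr M \<nu> \<psi> = \<nu>" for M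
  proof -
    have space_M: "space M = K" using M(1) by (rule space_borel_prob_measure)
    interpret prob_space M using M by (simp add: borel_prob_measure_def)
    have "content_on K (measure M)"
      using prob_space_axioms clopens_sets[OF M(1)] prob_space
      by (intro content_on_measure) (simp_all add: space_M)
    moreover have "measure M (K \<inter> \<psi> -` B) = measure \<nu> B" if "B \<in> sets \<nu>" for B
      using measure_distr[OF meas(1)[OF M(1)] that] M(3) by (simp add: space_M Int_commute)
    moreover have "measure M (K \<inter> T -` C) = measure M C" if "C \<in> clopens K" for C
      using measure_invariant[OF M(2), of C] clopens_sets[OF M(1)] that
      by (auto simp: space_M Int_commute)
    ultimately show ?thesis by (simp add: lift_contents_def)
  qed
  have "lift_contents K T \<psi> \<nu> \<noteq> {}"
    using \<nu>'(1,2) image T equi by (rule lift_contents_nonempty)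
  moreover have "continuous_on (lift_contents K T \<psi> \<nu>) (energy \<B> K)"
    by (rule continuous_on_subset[OF continuous_on_energy]) (auto simp: lift_contents_def)
  ultimately obtain \<mu> where \<mu>: "\<mu> \<in> lift_contents K T \<psi> \<nu>"
      and \<mu>_max: "\<And>\<mu>'. \<mu>' \<in> lift_contents K T \<psi> \<nu> \<Longrightarrow> energy \<B> K \<mu>' \<le> energy \<B> K \<mu>"
    using continuous_attains_sup[OF compact_lift_contents] by metis
  obtain M where M: "borel_prob_measure K M" and M_\<mu>: "\<And>C. C \<in> clopens K \<Longrightarrow> measure M C = \<mu> C"
    using content_on_extension[OF K \<B>, of \<mu>] \<mu> unfolding lift_contents_def by auto
  interpret M: prob_space M using M by (simp add: borel_prob_measure_def)
  have space_M: "space M = K" using M by (rule space_borel_prob_measure)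
  have setsM: "sets M = sets (restrict_space borel K)"
    using M by (simp add: borel_prob_measure_def)
  have inv: "invariant_measure T M"
    unfolding invariant_measure_def
  proof
    show "T \<in> measurable M M" using M by (rule meas)
    show "distr M M T = M"
    proof (rule borel_prob_measure_eqI[OF \<B> borel_closed[OF K(2)] _ M])
      show "borel_prob_measure K (distr M M T)"
        using M meas(2)[OF M] setsM by (rule borel_prob_measure_distr)
      fix U assume "U \<in> \<B>"
      then have U: "K \<inter> U \<in> clopens K" by (rule \<B>')
      then have "measure (distr M M T) (K \<inter> U) = measure M (K \<inter> T -` (K \<inter> U))"
        using measure_distr[OF meas(2)[OF M], of "K \<inter> U"] clopens_sets[OF M]
        by (auto simp: space_M Int_commute)
      also have "\<dots> = measure M (K \<inter> U)"
        using U \<mu> by (simp add: M_\<mu> clopens_vimage[OF T] lift_contents_def del: vimage_Int)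
      finally show "measure (distr M M T) (K \<inter> U) = measure M (K \<inter> U)" .
    qed
  qed
  have lift: "distr M \<nu> \<psi> = \<nu>"
  proof (rule borel_prob_measure_eqI[OF \<C> Y _ \<nu>(1)])
    show "borel_prob_measure Y (distr M \<nu> \<psi>)"
      using M meas(1)[OF M] \<nu>'(3) by (rule borel_prob_measure_distr)
    fix D assume D: "D \<in> \<C>"
    then have oc: "open D" "closed D"
      using \<C> by (auto simp: clopen_basis_def topological_basis_open)
    then have YD: "Y \<inter> D \<in> sets \<nu>"
      unfolding \<nu>'(3) sets_restrict_space by auto
    have "K \<inter> \<psi> -` (Y \<inter> D) \<in> clopens K"
      using \<psi> into clopens_Int[OF oc] by (rule clopens_vimage)
    then have "measure M (K \<inter> \<psi> -` (Y \<inter> D)) = measure \<nu> (Y \<inter> D)"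
      using \<mu> YD by (simp add: M_\<mu> lift_contents_def del: vimage_Int)
    then show "measure (distr M \<nu> \<psi>) (Y \<inter> D) = measure \<nu> (Y \<inter> D)"
      using measure_distr[OF meas(1)[OF M] YD] by (simp add: space_M Int_commute)
  qed
  have M_max: "energy \<B> K (measure N) \<le> energy \<B> K (measure M)"
    if "borel_prob_measure K N" "invariant_measure T N" "distr N \<nu> \<psi> = \<nu>" for N
  proof -
    have "energy \<B> K (measure M) = energy \<B> K \<mu>"
      unfolding energy_def using from_nat_into[OF \<B>'(2)] \<B>'(3) by (simp add: M_\<mu>)
    then show ?thesis using \<mu>_max[OF in_lift[OF that]] by simp
  qed
  have "measure M A = 0 \<or> measure M A = 1" if A: "A \<in> sets M" "T -` A \<inter> space M = A" for A
  proof (rule ccontr)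
    assume not: "\<not> (measure M A = 0 \<or> measure M A = 1)"
    define B where "B = space M - A"
    have T_space: "T ` space M \<subseteq> space M"
      using T(2) by (simp add: space_M)
    have B: "B \<in> sets M" "T -` B \<inter> space M = B"
    proof -
      show "B \<in> sets M" using A by (auto simp: B_def)
      have "T x \<in> A \<longleftrightarrow> x \<in> A" if "x \<in> space M" for x
        using that A(2) by blast
      then show "T -` B \<inter> space M = B"
        using T_space unfolding B_def by blast
    qed
    have pB: "measure M B = 1 - measure M A"
      unfolding B_def by (rule M.prob_compl[OF A(1)])
    have "0 < measure M A" "measure M A < 1"
      using not M.prob_le_1[of A] measure_nonneg[of M A] by linarith+
    note UA = uniform_measure_invariant_lift[OF M inv meas(1)[OF M] lift \<nu>'(1) \<nu>(2) equi A]
    note UB = uniform_measure_invariant_lift[OF M inv meas(1)[OF M] lift \<nu>'(1) \<nu>(2) equi B]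
    have UA': "borel_prob_measure K (uniform_measure M A)" "invariant_measure T (uniform_measure M A)"
         "distr (uniform_measure M A) \<nu> \<psi> = \<nu>"
     and UB': "borel_prob_measure K (uniform_measure M B)" "invariant_measure T (uniform_measure M B)"
         "distr (uniform_measure M B) \<nu> \<psi> = \<nu>"
      using UA UB not pB by auto
    have pos: "emeasure M A \<noteq> 0" "emeasure M B \<noteq> 0"
      using not pB by (auto simp: M.emeasure_eq_measure)
    have mA: "measure (uniform_measure M A) C = measure M (A \<inter> C) / measure M A" if "C \<in> sets M" for C
      using pos that by (simp add: M.emeasure_eq_measure)
    have mB: "measure (uniform_measure M B) C = measure M (B \<inter> C) / measure M B" if "C \<in> sets M" for C
      using pos that by (simp add: M.emeasure_eq_measure)
    have "uniform_measure M A = uniform_measure M B"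
    proof (rule borel_prob_measure_eqI[OF \<B> borel_closed[OF K(2)] UA'(1) UB'(1)])
      fix U assume U: "U \<in> \<B>"
      show "measure (uniform_measure M A) (K \<inter> U) = measure (uniform_measure M B) (K \<inter> U)"
      proof (rule energy_strictly_convex[OF \<B>'(1,2) \<open>0 < measure M A\<close> \<open>measure M A < 1\<close>
            _ _ _ M_max[OF UA'] M_max[OF UB'] U])
        interpret UA: prob_space "uniform_measure M A" using UA' by (simp add: borel_prob_measure_def)
        interpret UB: prob_space "uniform_measure M B" using UB' by (simp add: borel_prob_measure_def)
        show "0 \<le> measure (uniform_measure M A) C \<and> measure (uniform_measure M A) C \<le> 1" for C
          by (simp add: UA.prob_le_1)
        show "0 \<le> measure (uniform_measure M B) C \<and> measure (uniform_measure M B) C \<le> 1" for C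
          by (simp add: UB.prob_le_1)
        fix V assume "V \<in> \<B>"
        then have V: "K \<inter> V \<in> sets M"
          using \<B>'(3) clopens_sets[OF M] by blast
        have "K \<inter> V = (A \<inter> (K \<inter> V)) \<union> (B \<inter> (K \<inter> V))"
          using space_M by (auto simp: B_def)
        then have "measure M (K \<inter> V) = measure M (A \<inter> (K \<inter> V)) + measure M (B \<inter> (K \<inter> V))"
          using M.finite_measure_Union[of "A \<inter> (K \<inter> V)" "B \<inter> (K \<inter> V)"] A(1) B(1) V
          by (auto simp: B_def)
        then show "measure M (K \<inter> V) = measure M A * measure (uniform_measure M A) (K \<inter> V) +
            (1 - measure M A) * measure (uniform_measure M B) (K \<inter> V)"
          using not pB by (simp add: mA[OF V] mB[OF V])
      qed
    qed
    then have "measure M (A \<inter> A) / measure M A = measure M (B \<inter> A) / measure M B"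
      using mA[OF A(1)] mB[OF A(1)] by simp
    moreover have "B \<inter> A = {}" by (auto simp: B_def)
    ultimately show False using not by simp
  qed
  then have "ergodic_measure T M"
    using inv by (auto simp: ergodic_measure_def)
  then show ?thesis using M lift by blast
qed

section \<open>Sliding block codes\<close>

definition translate :: "int \<Rightarrow> (int \<Rightarrow> 'a) \<Rightarrow> int \<Rightarrow> 'a" where
  "translate n x = (\<lambda>i. x (i + n))"

lemma translate_0 [simp]: "translate 0 x = x"
  by (simp add: translate_def)

lemma translate_translate [simp]: "translate m (translate n x) = translate (m + n) x"
  by (simp add: translate_def add_ac)

lemma shift_eq_translate: "shift x = translate 1 x"
  by (simp add: shift_def translate_def)

lemma translate_factor_code:
  assumes "factor_code X Y \<pi>" "x \<in> X"
  shows "translate n x \<in> X \<and> \<pi> (translate n x) = translate n (\<pi> x)"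
proof -
  have S: "shift ` X = X" and comm: "\<And>x. x \<in> X \<Longrightarrow> \<pi> (shift x) = shift (\<pi> x)"
    using assms(1) by (auto simp: factor_code_def shift_space_def)
  show ?thesis
  proof (induction n rule: int_induct[where k=0])
    case base
    then show ?case using assms(2) by simp
  next
    case (step1 n)
    have "translate (n + 1) x = shift (translate n x)"
      by (simp add: shift_eq_translate add_ac)
    then show ?case
      using step1 S comm[of "translate n x"] imageI[of "translate n x" X shift]
      by (auto simp: shift_eq_translate add_ac)
  next
    case (step2 n)
    then obtain z where z: "z \<in> X" "translate n x = shift z"
      using S by (metis imageE)
    then have "translate (-1) (translate n x) = z"
      by (simp add: shift_eq_translate)
    then have z': "translate (n - 1) x = z" by simp
    have "translate n (\<pi> x) = shift (\<pi> z)"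
      using step2 z comm by simp
    then have "translate (-1) (translate n (\<pi> x)) = \<pi> z"
      by (simp add: shift_eq_translate)
    then show ?case using z z' by simp
  qed
qed

lemma compact_shift_space:
  fixes X :: "(int \<Rightarrow> 'a::alphabet) set"
  assumes "closed X" shows "compact X"
proof -
  have "compact (Pi\<^sub>E UNIV (\<lambda>_. UNIV) :: (int \<Rightarrow> 'a) set)"
    by (rule compact_PiE_UNIV) (simp add: finite_imp_compact)
  then show ?thesis
    using compact_Int_closed[OF _ assms] by fastforce
qed

lemma open_contains_cylinder:
  fixes U :: "(int \<Rightarrow> 'a::alphabet) set"
  assumes "open U" "x \<in> U"
  shows "\<exists>r::nat. \<forall>x'. (\<forall>i. \<bar>i\<bar> \<le> int r \<longrightarrow> x' i = x i) \<longrightarrow> x' \<in> U"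
proof -
  obtain V where V: "x \<in> Pi\<^sub>E UNIV V" "finite {i. V i \<noteq> UNIV}" "Pi\<^sub>E UNIV V \<subseteq> U"
    using product_topology_open_contains_basis[of "\<lambda>_. euclidean" UNIV U x] assms
    by (auto simp: open_fun_def)
  define r where "r = Max (insert 0 ((\<lambda>i. nat \<bar>i\<bar>) ` {i. V i \<noteq> UNIV}))"
  have r: "\<bar>i\<bar> \<le> int r" if "V i \<noteq> UNIV" for i
  proof -
    have "nat \<bar>i\<bar> \<le> r"
      unfolding r_def using V(2) that by (intro Max_ge) auto
    then show ?thesis by linarith
  qed
  have "x' \<in> U" if "\<forall>i. \<bar>i\<bar> \<le> int r \<longrightarrow> x' i = x i" for x'
  proof -
    have "x' i \<in> V i" for i
      using that r[of i] V(1) by (cases "V i = UNIV") (auto simp: PiE_iff)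
    then show ?thesis using V(3) by auto
  qed
  then show ?thesis by blast
qed

lemma open_cylinder:
  fixes x :: "int \<Rightarrow> 'a::alphabet"
  shows "open {x'. \<forall>i. \<bar>i\<bar> \<le> int r \<longrightarrow> x' i = x i}"
proof -
  have "{x'. \<forall>i. \<bar>i\<bar> \<le> int r \<longrightarrow> x' i = x i} = {x'. \<forall>i\<in>{-int r..int r}. x' (id i) \<in> {x i}}"
    by (auto simp: abs_le_iff)
  also have "open \<dots>"
    by (rule product_topology_basis') (auto simp: Topological_Spaces.open_discrete)
  finally show ?thesis .
qed

text \<open>
  The Curtis-Hedlund-Lyndon theorem: compactness of \<open>X\<close> bounds the window on which the symbol of \<open>\<pi> x\<close> at
  \<open>0\<close> depends, and equivariance transports the bound to all other positions.
\<close>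

lemma sliding_block_code:
  fixes X :: "(int \<Rightarrow> 'a::alphabet) set" and Y :: "(int \<Rightarrow> 'b::alphabet) set"
  assumes "factor_code X Y \<pi>"
  shows "\<exists>r::nat. \<forall>x\<in>X. \<forall>x'\<in>X. \<forall>t. (\<forall>i. \<bar>i - t\<bar> \<le> int r \<longrightarrow> x i = x' i) \<longrightarrow> \<pi> x t = \<pi> x' t"
proof -
  have X: "compact X" and cont: "continuous_on X \<pi>"
    using assms compact_shift_space by (auto simp: factor_code_def shift_space_def)
  have "continuous_on X (\<lambda>x. \<pi> x 0)"
    using cont by (rule continuous_on_product_then_coordinatewise)
  then have "\<exists>r::nat. \<forall>x'\<in>X. (\<forall>i. \<bar>i\<bar> \<le> int r \<longrightarrow> x' i = x i) \<longrightarrow> \<pi> x' 0 = \<pi> x 0"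
    if "x \<in> X" for x
  proof -
    have "openin (top_of_set X) (X \<inter> (\<lambda>x. \<pi> x 0) -` {\<pi> x 0})"
      using \<open>continuous_on X (\<lambda>x. \<pi> x 0)\<close>
      by (rule continuous_openin_preimage_gen) (rule Topological_Spaces.open_discrete)
    then obtain U where U: "open U" "X \<inter> (\<lambda>x. \<pi> x 0) -` {\<pi> x 0} = X \<inter> U"
      by (auto simp: openin_open)
    then have "x \<in> U" using that by auto
    then show ?thesis
      using open_contains_cylinder[OF U(1), of x] U(2) by (metis IntD2 IntI vimage_singleton_eq)
  qed
  then obtain r where r: "\<And>x x'. x \<in> X \<Longrightarrow> x' \<in> X \<Longrightarrow>
      (\<forall>i. \<bar>i\<bar> \<le> int (r x) \<longrightarrow> x' i = x i) \<Longrightarrow> \<pi> x' 0 = \<pi> x 0"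
    by metis
  define C where "C x = {x'. \<forall>i. \<bar>i\<bar> \<le> int (r x) \<longrightarrow> x' i = x i}" for x
  have C_open: "open (C x)" for x
    unfolding C_def by (rule open_cylinder)
  have cover: "X \<subseteq> (\<Union>x\<in>X. C x)"
    by (auto simp: C_def)
  obtain D where D: "D \<subseteq> X" "finite D" "X \<subseteq> (\<Union>x\<in>D. C x)"
    by (rule compactE_image[OF X C_open cover])
  define R where "R = Max (insert 0 (r ` D))"
  have zero: "\<pi> x 0 = \<pi> x' 0"
    if x: "x \<in> X" "x' \<in> X" and eq: "\<forall>i. \<bar>i\<bar> \<le> int R \<longrightarrow> x i = x' i" for x x'
  proof -
    obtain u where u: "u \<in> D" "x \<in> C u"
      using D(3) x(1) by auto
    then have "r u \<le> R"
      unfolding R_def using D(2) by (intro Max_ge) auto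
    then have "x' \<in> C u"
      using u(2) eq by (auto simp: C_def)
    then show ?thesis
      using r[of u x] r[of u x'] u x D(1) by (auto simp: C_def)
  qed
  have "\<pi> x t = \<pi> x' t"
    if x: "x \<in> X" "x' \<in> X" and eq: "\<forall>i. \<bar>i - t\<bar> \<le> int R \<longrightarrow> x i = x' i" for x x' t
  proof -
    have "\<pi> (translate t x) 0 = \<pi> (translate t x') 0"
    proof (rule zero)
      show "\<forall>i. \<bar>i\<bar> \<le> int R \<longrightarrow> translate t x i = translate t x' i"
        using eq by (auto simp: translate_def)
    qed (use translate_factor_code[OF assms] x in auto)
    then show ?thesis
      using translate_factor_code[OF assms] x by (simp add: translate_def)
  qed
  then show ?thesis by blast
qed

section \<open>Gluing and transitions\<close>

definition glue :: "int \<Rightarrow> (int \<Rightarrow> 'a) \<Rightarrow> (int \<Rightarrow> 'a) \<Rightarrow> int \<Rightarrow> 'a" where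
  "glue t x x' = (\<lambda>i. if i \<le> t then x i else x' i)"

text \<open>
  The consequence of finite type and continuity on which the argument rests: two points that agree on
  a window of radius \<open>R\<close> around \<open>t\<close> can be glued at \<open>t\<close>, and the code sees the left point up to \<open>t\<close> and the right
  point from \<open>t\<close> on. The window plays the role of the single common symbol in the case of a 1-block code on a
  1-step shift.
\<close>

locale gluing_code =
  fixes X :: "(int \<Rightarrow> 'a::alphabet) set" and Y :: "(int \<Rightarrow> 'b::alphabet) set"
    and \<pi> :: "(int \<Rightarrow> 'a) \<Rightarrow> (int \<Rightarrow> 'b)" and R :: int
  assumes factor: "factor_code X Y \<pi>"
    and R_nonneg: "0 \<le> R"
    and glue: "\<lbrakk>x \<in> X; x' \<in> X; \<forall>i\<in>{t-R..t+R}. x i = x' i\<rbrakk> \<Longrightarrow>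
      glue t x x' \<in> X \<and> (\<forall>j\<le>t. \<pi> (glue t x x') j = \<pi> x j) \<and> (\<forall>j\<ge>t. \<pi> (glue t x x') j = \<pi> x' j)"

lemma gluing_code_SFT:
  fixes X :: "(int \<Rightarrow> 'a::alphabet) set" and Y :: "(int \<Rightarrow> 'b::alphabet) set"
  assumes "SFT X" "factor_code X Y \<pi>"
  shows "\<exists>R. gluing_code X Y \<pi> R"
proof -
  obtain F where F: "finite F" "X = {x. \<forall>w\<in>F. \<forall>i. \<not> occurs_at w x i}"
    using assms(1) by (auto simp: SFT_def)
  obtain r :: nat where r: "\<And>x x' t. x \<in> X \<Longrightarrow> x' \<in> X \<Longrightarrow>
      (\<forall>i. \<bar>i - t\<bar> \<le> int r \<longrightarrow> x i = x' i) \<Longrightarrow> \<pi> x t = \<pi> x' t"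
    using sliding_block_code[OF assms(2)] by blast
  define m where "m = Max (insert 0 (length ` F))"
  have m: "length w \<le> m" if "w \<in> F" for w
    unfolding m_def using F(1) that by (intro Max_ge) auto
  \<comment> \<open>A radius that covers both the forbidden words and the window of the block code.\<close>
  define R where "R = int (m + r)"
  have "gluing_code X Y \<pi> R"
  proof
    fix x x' t
    assume x: "x \<in> X" "x' \<in> X" and agree: "\<forall>i\<in>{t-R..t+R}. x i = x' i"
    have left: "glue t x x' i = x i" if "i \<le> t + R" for i
      using agree that by (cases "i \<le> t") (auto simp: glue_def R_def)
    have right: "glue t x x' i = x' i" if "t - R \<le> i" for i
      using agree that by (cases "i \<le> t") (auto simp: glue_def R_def)
    have "\<not> occurs_at w (glue t x x') i" if "w \<in> F" for w i
    proof (cases "i \<le> t")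
      case True
      then have "glue t x x' (i + int k) = x (i + int k)" if "k < length w" for k
        using m[OF \<open>w \<in> F\<close>] that by (intro left) (simp add: R_def)
      then have "occurs_at w (glue t x x') i = occurs_at w x i"
        by (simp add: occurs_at_def)
      then show ?thesis using F x that by auto
    next
      case False
      then have "glue t x x' (i + int k) = x' (i + int k)" for k
        by (simp add: glue_def)
      then have "occurs_at w (glue t x x') i = occurs_at w x' i"
        by (simp add: occurs_at_def)
      then show ?thesis using F x that by auto
    qed
    then have "glue t x x' \<in> X" using F by auto
    moreover have "\<pi> (glue t x x') j = \<pi> x j" if "j \<le> t" for j
      using \<open>glue t x x' \<in> X\<close> x(1) that by (intro r) (auto simp: R_def intro!: left)
    moreover have "\<pi> (glue t x x') j = \<pi> x' j" if "j \<ge> t" for j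
      using \<open>glue t x x' \<in> X\<close> x(2) that by (intro r) (auto simp: R_def intro!: right)
    ultimately show "glue t x x' \<in> X \<and> (\<forall>j\<le>t. \<pi> (glue t x x') j = \<pi> x j) \<and>
        (\<forall>j\<ge>t. \<pi> (glue t x x') j = \<pi> x' j)"
      by blast
  qed (use assms in \<open>auto simp: R_def\<close>)
  then show ?thesis by blast
qed

context gluing_code
begin

lemma closed_X: "closed X" and cont: "continuous_on X \<pi>" and image: "\<pi> ` X = Y" and closed_Y: "closed Y"
  using factor by (auto simp: factor_code_def shift_space_def)

text \<open>
  A finite path over the image of \<open>x\<close>, leading from \<open>x\<close> at time \<open>n\<close> to \<open>x'\<close> at time \<open>m\<close>. The point
  \<open>z\<close> only matters on a bounded interval, so for fixed \<open>n\<close> and \<open>m\<close> this is an open condition on \<open>(x, x')\<close>.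
\<close>

definition link :: "int \<Rightarrow> int \<Rightarrow> (int \<Rightarrow> 'a) \<Rightarrow> (int \<Rightarrow> 'a) \<Rightarrow> bool" where
  "link n m x x' \<longleftrightarrow> (\<exists>z\<in>X. (\<forall>i\<in>{n-R..n+R}. x i = z i) \<and> (\<forall>i\<in>{m-R..m+R}. x' i = z i) \<and>
     (\<forall>j\<in>{n..m}. \<pi> x j = \<pi> z j))"

lemma link_imp_path:
  assumes x: "x \<in> X" "x' \<in> X" "\<pi> x = y" "\<pi> x' = y" and "n \<le> m" "link n m x x'"
  shows "\<exists>z\<in>X. \<pi> z = y \<and> (\<forall>i\<le>n. z i = x i) \<and> (\<forall>i>m. z i = x' i)"
proof -
  obtain z where z: "z \<in> X" "\<forall>i\<in>{n-R..n+R}. x i = z i" "\<forall>i\<in>{m-R..m+R}. x' i = z i"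
      "\<forall>j\<in>{n..m}. \<pi> x j = \<pi> z j"
    using assms(6) by (auto simp: link_def)
  define u where "u = glue n x z"
  have u: "u \<in> X" "\<And>j. j \<le> n \<Longrightarrow> \<pi> u j = \<pi> x j" "\<And>j. j \<ge> n \<Longrightarrow> \<pi> u j = \<pi> z j"
    using glue[OF x(1) z(1,2)] by (auto simp: u_def)
  have agree: "\<forall>i\<in>{m-R..m+R}. u i = x' i"
    using z(2,3) assms(5) R_nonneg by (auto simp: u_def glue_def)
  define w where "w = glue m u x'"
  have w: "w \<in> X" "\<And>j. j \<le> m \<Longrightarrow> \<pi> w j = \<pi> u j" "\<And>j. j \<ge> m \<Longrightarrow> \<pi> w j = \<pi> x' j"
    using glue[OF u(1) x(2) agree] by (auto simp: w_def)
  have "\<pi> w j = y j" for j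
  proof -
    consider "j \<le> n" | "n \<le> j" "j \<le> m" | "m \<le> j" by linarith
    then show ?thesis
      using u w z(4) x assms(5) by cases auto
  qed
  then have "\<pi> w = y" by auto
  moreover have "\<forall>i\<le>n. w i = x i" "\<forall>i>m. w i = x' i"
    using assms(5) by (auto simp: w_def u_def glue_def)
  ultimately show ?thesis using w(1) by blast
qed

lemma transition_iff_link:
  assumes x: "x \<in> X" "x' \<in> X" "\<pi> x = y" "\<pi> x' = y"
  shows "transition X \<pi> y x x' \<longleftrightarrow> (\<forall>n. \<exists>m\<ge>n. link n m x x')"
proof
  assume tr: "transition X \<pi> y x x'"
  show "\<forall>n. \<exists>m\<ge>n. link n m x x'"
  proof
    fix n
    obtain z m where z: "z \<in> X" "\<pi> z = y" "\<forall>i\<le>n+R. z i = x i" "\<forall>i\<ge>m. z i = x' i"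
      using tr unfolding transition_def by blast
    have "link n (max n (m + R)) x x'"
      unfolding link_def using z x by (intro bexI[of _ z]) auto
    then show "\<exists>m\<ge>n. link n m x x'"
      by (intro exI[of _ "max n (m + R)"]) auto
  qed
next
  assume l: "\<forall>n. \<exists>m\<ge>n. link n m x x'"
  show "transition X \<pi> y x x'"
    unfolding transition_def
  proof
    fix n
    obtain m where "m \<ge> n" "link n m x x'" using l by blast
    then obtain z where "z \<in> X" "\<pi> z = y" "\<forall>i\<le>n. z i = x i" "\<forall>i>m. z i = x' i"
      using link_imp_path[OF x] by blast
    then show "\<exists>z\<in>X. \<pi> z = y \<and> (\<forall>i\<le>n. z i = x i) \<and> (\<exists>m. \<forall>i\<ge>m. z i = x' i)"
      by (intro bexI[of _ z] conjI exI[of _ "m + 1"]) auto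
  qed
qed

text \<open>
  Following \<open>x\<close> up to time \<open>n'\<close> is part of a path that leaves \<open>x\<close> earlier.
\<close>

lemma link_antimono:
  assumes "x \<in> X" "n \<le> n'" "n' \<le> m" "link n' m x x'"
  shows "link n m x x'"
proof -
  obtain z where z: "z \<in> X" "\<forall>i\<in>{n'-R..n'+R}. x i = z i" "\<forall>i\<in>{m-R..m+R}. x' i = z i"
      "\<forall>j\<in>{n'..m}. \<pi> x j = \<pi> z j"
    using assms(4) by (auto simp: link_def)
  define u where "u = glue n' x z"
  have u: "u \<in> X" "\<And>j. j \<le> n' \<Longrightarrow> \<pi> u j = \<pi> x j" "\<And>j. j \<ge> n' \<Longrightarrow> \<pi> u j = \<pi> z j"
    using glue[OF assms(1) z(1,2)] by (auto simp: u_def)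
  have "\<pi> x j = \<pi> u j" if "j \<le> m" for j
    using u z(4) that by (cases "j \<le> n'") auto
  moreover have "\<forall>i\<in>{n-R..n+R}. x i = u i" "\<forall>i\<in>{m-R..m+R}. x' i = u i"
    using z(2,3) assms(2,3) R_nonneg by (auto simp: u_def glue_def)
  ultimately show ?thesis
    unfolding link_def using u(1) by auto
qed

lemma link_translate:
  assumes "x \<in> X" "link (n + k) (m + k) x x'"
  shows "link n m (translate k x) (translate k x')"
proof -
  obtain z where z: "z \<in> X" "\<forall>i\<in>{n+k-R..n+k+R}. x i = z i" "\<forall>i\<in>{m+k-R..m+k+R}. x' i = z i"
      "\<forall>j\<in>{n+k..m+k}. \<pi> x j = \<pi> z j"
    using assms(2) by (auto simp: link_def)
  have "translate k z \<in> X" "\<pi> (translate k z) = translate k (\<pi> z)"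
      "\<pi> (translate k x) = translate k (\<pi> x)"
    using translate_factor_code[OF factor] z(1) assms(1) by auto
  then show ?thesis
    unfolding link_def using z(2-4)
    by (intro bexI[of _ "translate k z"]) (auto simp: translate_def)
qed

text \<open>
  There is no transition from \<open>x\<close> to \<open>x'\<close> iff \<open>blocked n x x'\<close> for some \<open>n\<close>. For each single \<open>n\<close> the
  condition is closed, as it negates open ones, and it weakens as \<open>n\<close> grows.
\<close>

definition blocked :: "int \<Rightarrow> (int \<Rightarrow> 'a) \<Rightarrow> (int \<Rightarrow> 'a) \<Rightarrow> bool" where
  "blocked n x x' \<longleftrightarrow> (\<forall>m\<ge>n. \<not> link n m x x')"

definition apart :: "int \<Rightarrow> (int \<Rightarrow> 'a) \<Rightarrow> (int \<Rightarrow> 'a) \<Rightarrow> bool" where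
  "apart n x x' \<longleftrightarrow> blocked n x x' \<or> blocked n x' x"

lemma blocked_mono: "blocked n x x' \<Longrightarrow> n \<le> n' \<Longrightarrow> x \<in> X \<Longrightarrow> blocked n' x x'"
  unfolding blocked_def using link_antimono order_trans by blast

lemma apart_mono: "apart n x x' \<Longrightarrow> n \<le> n' \<Longrightarrow> x \<in> X \<Longrightarrow> x' \<in> X \<Longrightarrow> apart n' x x'"
  unfolding apart_def using blocked_mono by blast

lemma apart_translate:
  assumes "x \<in> X" "x' \<in> X"
  shows "apart n (translate k x) (translate k x') \<longleftrightarrow> apart (n + k) x x'"
proof -
  have "blocked n (translate k u) (translate k u') \<longleftrightarrow> blocked (n + k) u u'" if u: "u \<in> X" for u u'
  proof -
    have "link n m (translate k u) (translate k u') \<longleftrightarrow> link (n + k) (m + k) u u'" for m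
      using link_translate[OF u, of n k m u'] translate_factor_code[OF factor u]
        link_translate[of "translate k u" "n + k" "- k" "m + k" "translate k u'"] by auto
    then have "blocked n (translate k u) (translate k u') \<longleftrightarrow> (\<forall>m\<ge>n. \<not> link (n + k) (m + k) u u')"
      by (simp add: blocked_def)
    also have "\<dots> \<longleftrightarrow> blocked (n + k) u u'"
      unfolding blocked_def
    proof safe
      fix m assume *: "\<forall>m\<ge>n. \<not> link (n + k) (m + k) u u'" "n + k \<le> m" "link (n + k) m u u'"
      from *(1)[rule_format, of "m - k"] *(2,3) show False by simp
    qed auto
    finally show ?thesis .
  qed
  then show ?thesis
    using assms by (simp add: apart_def)
qed

text \<open>
  Points that agree on a window can pass into each other at once. This bounds the number of pairwise
  separated points by the number of words of length \<open>2 R + 1\<close>.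
\<close>

lemma apart_imp_windows_differ:
  assumes "x \<in> X" "x' \<in> X" "apart n x x'"
  shows "\<exists>i\<in>{n-R..n+R}. x i \<noteq> x' i"
proof (rule ccontr)
  assume "\<not> ?thesis"
  then have eq: "\<forall>i\<in>{n-R..n+R}. x i = x' i" by auto
  then have "glue n x x' \<in> X \<and> \<pi> (glue n x x') n = \<pi> x n \<and> \<pi> (glue n x x') n = \<pi> x' n"
    using glue[OF assms(1,2), of n] by auto
  then have "\<pi> x n = \<pi> x' n" by metis
  then have "link n n x x'" "link n n x' x"
    unfolding link_def using eq assms by (auto intro!: bexI[of _ x])
  then show False
    using assms(3) by (auto simp: apart_def blocked_def)
qed

lemma transition_trans:
  assumes "transition X \<pi> y x x'" "transition X \<pi> y x' x''"
  shows "transition X \<pi> y x x''"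
  unfolding transition_def
proof
  fix n
  obtain z m where z: "z \<in> X" "\<pi> z = y" "\<forall>i\<le>n. z i = x i" "\<forall>i\<ge>m. z i = x' i"
    using assms(1) unfolding transition_def by blast
  define t where "t = max n (m + R)"
  obtain w m' where w: "w \<in> X" "\<pi> w = y" "\<forall>i\<le>t+R. w i = x' i" "\<forall>i\<ge>m'. w i = x'' i"
    using assms(2) unfolding transition_def by blast
  have agree: "\<forall>i\<in>{t-R..t+R}. z i = w i"
    using z(4) w(3) by (auto simp: t_def)
  note g = glue[OF z(1) w(1) agree]
  have "\<pi> (glue t z w) j = y j" for j
    using g z(2) w(2) by (cases "j \<le> t") auto
  then have "\<pi> (glue t z w) = y" by auto
  moreover have "\<forall>i\<le>n. glue t z w i = x i"
    using z(3) by (auto simp: glue_def t_def)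
  moreover have "\<forall>i\<ge>max (t + 1) m'. glue t z w i = x'' i"
    using w(4) by (auto simp: glue_def)
  ultimately show "\<exists>z\<in>X. \<pi> z = y \<and> (\<forall>i\<le>n. z i = x i) \<and> (\<exists>m. \<forall>i\<ge>m. z i = x'' i)"
    using g by blast
qed

lemma equiv_transition: "equiv (fiber X \<pi> y) (transition_equiv X \<pi> y)"
proof (rule equivI)
  have "transition X \<pi> y x x" if "x \<in> fiber X \<pi> y" for x
    using that by (auto simp: transition_def fiber_def intro!: bexI[of _ x])
  then show "refl_on (fiber X \<pi> y) (transition_equiv X \<pi> y)"
    by (auto simp: refl_on_def transition_equiv_def)
  show "sym (transition_equiv X \<pi> y)"
    by (auto simp: sym_def transition_equiv_def)
  show "trans (transition_equiv X \<pi> y)"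
    by (auto simp: trans_def transition_equiv_def intro: transition_trans)
qed (auto simp: transition_equiv_def)

lemma inequivalent_iff_apart:
  assumes "x \<in> X" "x' \<in> X" "\<pi> x = y" "\<pi> x' = y"
  shows "(x, x') \<notin> transition_equiv X \<pi> y \<longleftrightarrow> (\<exists>n. apart n x x')"
  using assms transition_iff_link[of x x' y] transition_iff_link[of x' x y]
  by (auto simp: transition_equiv_def fiber_def apart_def blocked_def)

end

section \<open>Tuples of separated points\<close>

text \<open>
  These rules show that a subset of a fixed closed set is closed by following the logical structure of its
  defining condition.
\<close>

lemma closed_within_conj:
  "closed {p\<in>S. P p} \<Longrightarrow> closed {p\<in>S. Q p} \<Longrightarrow> closed {p\<in>S. P p \<and> Q p}"
  using closed_Int[of "{p\<in>S. P p}" "{p\<in>S. Q p}"] by (simp add: Collect_conj_eq Int_ac)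

lemma closed_within_disj:
  "closed {p\<in>S. P p} \<Longrightarrow> closed {p\<in>S. Q p} \<Longrightarrow> closed {p\<in>S. P p \<or> Q p}"
  using closed_Un[of "{p\<in>S. P p}" "{p\<in>S. Q p}"] by (simp add: Collect_disj_eq[symmetric] conj_disj_distribL)

lemma closed_within_all:
  assumes "closed S" "\<And>a. closed {p\<in>S. P a p}"
  shows "closed {p\<in>S. \<forall>a. P a p}"
proof -
  have "{p\<in>S. \<forall>a. P a p} = S \<inter> (\<Inter>a. {p\<in>S. P a p})" by auto
  then show ?thesis using assms by (auto intro!: closed_Int closed_INT)
qed

lemma closed_within_imp:
  assumes "closed S" "c \<Longrightarrow> closed {p\<in>S. P p}"
  shows "closed {p\<in>S. c \<longrightarrow> P p}"
  using assms by (cases c) auto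

lemma openin_agree:
  fixes f :: "'i \<Rightarrow> 'p::topological_space \<Rightarrow> 'c::discrete_topology"
  assumes "finite A" "\<And>a. a \<in> A \<Longrightarrow> continuous_on S (f a)"
  shows "openin (top_of_set S) {p\<in>S. \<forall>a\<in>A. f a p = c a}"
  using assms
proof (induction A)
  case (insert a A)
  have "openin (top_of_set S) (S \<inter> f a -` {c a})"
    using insert.prems by (intro continuous_openin_preimage_gen Topological_Spaces.open_discrete) auto
  moreover have "openin (top_of_set S) {p\<in>S. \<forall>a\<in>A. f a p = c a}"
    using insert.prems by (intro insert.IH) auto
  ultimately have "openin (top_of_set S) ((S \<inter> f a -` {c a}) \<inter> {p\<in>S. \<forall>a\<in>A. f a p = c a})"
    by (rule openin_Int)
  also have "(S \<inter> f a -` {c a}) \<inter> {p\<in>S. \<forall>a\<in>A. f a p = c a} = {p\<in>S. \<forall>a\<in>insert a A. f a p = c a}"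
    by auto
  finally show ?case .
qed auto

lemma closed_within_not:
  assumes "closed S" "openin (top_of_set S) {p\<in>S. P p}"
  shows "closed {p\<in>S. \<not> P p}"
proof -
  have "{p\<in>S. \<not> P p} = S - {p\<in>S. P p}" by auto
  then show ?thesis
    using assms closedin_diff[of "top_of_set S" S "{p\<in>S. P p}"] closedin_closed_trans by fastforce
qed

lemma closed_within_eq:
  fixes f g :: "'p::topological_space \<Rightarrow> int \<Rightarrow> 'c::discrete_topology"
  assumes "closed S" "continuous_on S f" "continuous_on S g"
  shows "closed {p\<in>S. f p = g p}"
proof -
  have "closed {p\<in>S. \<forall>a. f p a = g p a}"
  proof (rule closed_within_all[OF assms(1)])
    fix a
    have "continuous_on S (\<lambda>p. f p a)" "continuous_on S (\<lambda>p. g p a)"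
      using assms by (auto intro: continuous_on_product_then_coordinatewise)
    then have "continuous_on S (\<lambda>p. (f p a, g p a))"
      by (rule continuous_on_Pair)
    then have "closed (S \<inter> (\<lambda>p. (f p a, g p a)) -` {y. \<exists>x. y = (x, x)})"
      using assms(1) closed_diagonal by (rule continuous_closed_preimage)
    then show "closed {p\<in>S. f p a = g p a}"
      by (rule back_subst[of closed]) auto
  qed
  then show ?thesis by (simp add: fun_eq_iff)
qed

lemma power_space_coord: "p \<in> power_space k X \<Longrightarrow> i < k \<Longrightarrow> p i \<in> X"
  by (auto simp: power_space_def)

lemma compact_power_space:
  fixes X :: "(int \<Rightarrow> 'a::alphabet) set"
  assumes "closed X"
  shows "compact (power_space k X)" "closed (power_space k X)"
proof -
  have cl: "closed {u}" for u :: "int \<Rightarrow> 'a"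
    using closed_within_eq[of UNIV "\<lambda>z. z" "\<lambda>_. u"] by simp
  have eq: "power_space k X = Pi\<^sub>E UNIV (\<lambda>i. if i < k then X else {undefined})"
  proof -
    have "x i \<in> (if i < k then X else {undefined}) \<longleftrightarrow> (i < k \<longrightarrow> x i \<in> X) \<and> (\<not> i < k \<longrightarrow> x i = undefined)"
      for x :: "nat \<Rightarrow> int \<Rightarrow> 'a" and i
      by simp
    then show ?thesis
      unfolding power_space_def set_eq_iff PiE_iff extensional_def by auto
  qed
  show "compact (power_space k X)"
    unfolding eq by (rule compact_PiE_UNIV) (auto intro: compact_shift_space assms)
  have "power_space k X = (\<Inter>i. (\<lambda>p. p i) -` (if i < k then X else {undefined}))"
    unfolding eq by (auto simp: PiE_iff)
  also have "closed \<dots>"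
    by (intro closed_INT ballI closed_vimage) (auto intro: cl assms)
  finally show "closed (power_space k X)" .
qed

lemma continuous_on_coord_power_space:
  "continuous_on S (\<lambda>p. p i)"
  by (rule continuous_on_subset[OF continuous_on_product_coordinates]) simp

lemma continuous_on_coord_coord: "continuous_on S (\<lambda>p. p i j)"
  by (rule continuous_on_product_then_coordinatewise[where f = "\<lambda>p. p i"])
     (rule continuous_on_coord_power_space)

lemma power_shift_continuous:
  fixes S :: "(nat \<Rightarrow> int \<Rightarrow> 'a::topological_space) set"
  shows "continuous_on S (power_shift k)"
proof (intro continuous_on_coordinatewise_then_product)
  fix i j
  show "continuous_on S (\<lambda>p. power_shift k p i j)"
  proof (cases "i < k")
    case True
    then have "power_shift k p i j = p i (j + 1)" for p :: "nat \<Rightarrow> int \<Rightarrow> 'a"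
      by (simp add: power_shift_def shift_def)
    then show ?thesis
      by (simp add: continuous_on_coord_coord)
  qed (simp add: power_shift_def)
qed

context gluing_code
begin

text \<open>
  Tuples over a common point whose entries are separated from time \<open>n\<close> on. These sets are compact,
  increase with \<open>n\<close>, and the shift maps each of them to the one for \<open>n - 1\<close>.
\<close>

definition tuples :: "nat \<Rightarrow> int \<Rightarrow> (nat \<Rightarrow> int \<Rightarrow> 'a) set" where
  "tuples k n = {p\<in>power_space k X. \<forall>i j. i < k \<and> j < k \<longrightarrow>
     \<pi> (p i) = \<pi> (p j) \<and> (i \<noteq> j \<longrightarrow> apart n (p i) (p j))}"

lemma tuples_subset_power_space: "tuples k n \<subseteq> power_space k X"
  by (auto simp: tuples_def)

lemma tuplesD:
  assumes "p \<in> tuples k n" "i < k"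
  shows "p i \<in> X" "j < k \<Longrightarrow> \<pi> (p i) = \<pi> (p j)"
    "j < k \<Longrightarrow> i \<noteq> j \<Longrightarrow> apart n (p i) (p j)"
proof -
  have p: "p \<in> power_space k X"
    using assms(1) tuples_subset_power_space by blast
  show "p i \<in> X" using p assms(2) by (rule power_space_coord)
  have *: "\<forall>i j. i < k \<and> j < k \<longrightarrow> \<pi> (p i) = \<pi> (p j) \<and> (i \<noteq> j \<longrightarrow> apart n (p i) (p j))"
    using assms(1) unfolding tuples_def mem_Collect_eq by (rule conjunct2)
  show "j < k \<Longrightarrow> \<pi> (p i) = \<pi> (p j)" "j < k \<Longrightarrow> i \<noteq> j \<Longrightarrow> apart n (p i) (p j)"
    using *[THEN spec[of _ i], THEN spec[of _ j]] assms(2) by blast+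
qed

lemma closed_blocked:
  assumes "i < k" "j < k"
  shows "closed {p\<in>power_space k X. blocked n (p i) (p j)}"
proof -
  let ?S = "power_space k X"
  note S = compact_power_space(2)[OF closed_X, of k]
  have c: "continuous_on ?S (\<lambda>p. p i a)" "continuous_on ?S (\<lambda>p. p j a)" for a
    by (rule continuous_on_coord_coord)+
  have c\<pi>: "continuous_on ?S (\<lambda>p. \<pi> (p i) a)" for a
  proof (rule continuous_on_product_then_coordinatewise[where f = "\<lambda>p. \<pi> (p i)"])
    show "continuous_on ?S (\<lambda>p. \<pi> (p i))"
      by (rule continuous_on_compose2[OF cont continuous_on_coord_power_space])
         (use power_space_coord[OF _ assms(1)] in auto)
  qed
  have "openin (top_of_set ?S) {p\<in>?S. link n m (p i) (p j)}" for m
  proof -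
    have "openin (top_of_set ?S) (\<Union>z\<in>X. {p\<in>?S. \<forall>a\<in>{n-R..n+R}. p i a = z a} \<inter>
       {p\<in>?S. \<forall>a\<in>{m-R..m+R}. p j a = z a} \<inter> {p\<in>?S. \<forall>a\<in>{n..m}. \<pi> (p i) a = \<pi> z a})"
      by (intro openin_Union openin_Int openin_agree ballI c c\<pi> | safe)+
    then show ?thesis
      by (rule back_subst[of "openin (top_of_set ?S)"]) (auto simp: link_def)
  qed
  then show ?thesis
    unfolding blocked_def
    by (intro closed_within_all closed_within_imp closed_within_not S)
qed

lemma closed_tuples: "closed (tuples k n)" and compact_tuples: "compact (tuples k n)"
proof -
  note S = compact_power_space[OF closed_X, of k]
  have "continuous_on (power_space k X) (\<lambda>p. \<pi> (p i))" if "i < k" for i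
    using continuous_on_compose2[OF cont continuous_on_coord_power_space[of "power_space k X" i]]
      power_space_coord[OF _ that] by auto
  then show "closed (tuples k n)"
    unfolding tuples_def apart_def
    by (intro closed_within_all closed_within_imp closed_within_conj closed_within_disj S
        closed_within_eq closed_blocked) auto
  then show "compact (tuples k n)"
    using compact_Int_closed[OF S(1)] by (metis tuples_subset_power_space inf.absorb2)
qed

lemma tuples_mono: "n \<le> n' \<Longrightarrow> tuples k n \<subseteq> tuples k n'"
  unfolding tuples_def using apart_mono power_space_coord by blast

lemma power_shift_tuples:
  assumes p: "p \<in> power_space k X"
  shows "power_shift k p \<in> tuples k n \<longleftrightarrow> p \<in> tuples k (n + 1)"
proof -
  have sh: "power_shift k p i = translate 1 (p i)" if "i < k" for i
    using that by (simp add: power_shift_def shift_eq_translate)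
  have t: "translate 1 (p i) \<in> X" "\<pi> (translate 1 (p i)) = translate 1 (\<pi> (p i))" if "i < k" for i
    using translate_factor_code[OF factor] power_space_coord[OF p that] by auto
  have inj: "translate 1 u = translate 1 v \<longleftrightarrow> u = v" for u v :: "int \<Rightarrow> 'c"
    by (metis translate_translate translate_0 add.right_inverse add.commute)
  have "power_shift k p \<in> power_space k X"
    using t(1) by (auto simp: power_space_def power_shift_def shift_eq_translate)
  then show ?thesis
    using p unfolding tuples_def
    by (auto simp: sh t inj apart_translate power_space_coord)
qed

lemma power_shift_preimage:
  assumes p: "p \<in> power_space k X"
  obtains q where "q \<in> power_space k X" "power_shift k q = p"
proof
  define q where "q = (\<lambda>i\<in>{..<k}. translate (-1) (p i))"
  show "q \<in> power_space k X"
    using translate_factor_code[OF factor] power_space_coord[OF p]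
    by (auto simp: q_def power_space_def)
  show "power_shift k q = p"
    using p by (auto simp: q_def power_shift_def shift_eq_translate power_space_def fun_eq_iff
        PiE_iff extensional_def restrict_def)
qed

lemma tuples_inj:
  assumes "p \<in> tuples k n"
  shows "inj_on (\<lambda>i. transition_class X \<pi> (p i)) {..<k}"
proof (rule inj_onI, rule ccontr)
  fix i j assume ij: "i \<in> {..<k}" "j \<in> {..<k}" "i \<noteq> j"
    and eq: "transition_class X \<pi> (p i) = transition_class X \<pi> (p j)"
  define y where "y = \<pi> (p i)"
  have p: "p i \<in> X" "p j \<in> X" "\<pi> (p j) = y" "apart n (p i) (p j)"
    using tuplesD(1)[OF assms, of i] tuplesD(1)[OF assms, of j] tuplesD(2)[OF assms, of j i]
      tuplesD(3)[OF assms, of i j] ij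
    unfolding y_def lessThan_iff by blast+
  have "(p i, p j) \<in> transition_equiv X \<pi> y"
    using eq p eq_equiv_class_iff[OF equiv_transition[of y], of "p i" "p j"]
    by (auto simp: transition_class_def y_def fiber_def)
  then show False
    using inequivalent_iff_apart[of "p i" "p j" y] p by (auto simp: y_def)
qed

lemma tuples_bound:
  assumes "p \<in> tuples k n"
  shows "k \<le> CARD('a) ^ nat (2 * R + 1)"
proof -
  define g where "g i = restrict (p i) {n-R..n+R}" for i
  have "inj_on g {..<k}"
  proof (rule inj_onI, rule ccontr)
    fix i j assume ij: "i \<in> {..<k}" "j \<in> {..<k}" "g i = g j" "i \<noteq> j"
    have "p i \<in> X" "p j \<in> X" "apart n (p i) (p j)"
      using tuplesD(1)[OF assms, of i] tuplesD(1)[OF assms, of j] tuplesD(3)[OF assms, of i j] ij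
      unfolding lessThan_iff by blast+
    from apart_imp_windows_differ[OF this] show False
      using ij(3) unfolding g_def by (metis restrict_apply')
  qed
  moreover have "g ` {..<k} \<subseteq> (\<Pi>\<^sub>E a\<in>{n-R..n+R}. UNIV)"
    by (auto simp: g_def)
  ultimately have "card {..<k} \<le> card (\<Pi>\<^sub>E a\<in>{n-R..n+R}. (UNIV :: 'a set))"
    by (intro card_inj_on_le) (auto intro!: finite_PiE)
  also have "\<dots> = CARD('a) ^ nat (2 * R + 1)"
    by (simp add: card_PiE)
  finally show ?thesis by simp
qed

text \<open>
  The points of \<open>Y\<close> that have a \<open>k\<close>-tuple of points over them separated from time \<open>n\<close> on. For \<open>k > 0\<close> their union
  over all \<open>n\<close> consists of the points with at least \<open>k\<close> transition classes; this is why that set is measurable.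
\<close>

definition over :: "nat \<Rightarrow> int \<Rightarrow> (int \<Rightarrow> 'b) set" where
  "over k n = (\<lambda>p. \<pi> (p 0)) ` tuples k n"

lemma overD:
  assumes "y \<in> over k n" "0 < k"
  shows "\<exists>p\<in>tuples k n. \<forall>i<k. p i \<in> X \<and> \<pi> (p i) = y"
proof -
  obtain p where p: "p \<in> tuples k n" "y = \<pi> (p 0)"
    using assms(1) by (auto simp: over_def)
  have "p i \<in> X \<and> \<pi> (p i) = y" if "i < k" for i
    using tuplesD(1)[OF p(1) that] tuplesD(2)[OF p(1) that assms(2)] p(2) by simp
  then show ?thesis using p(1) by blast
qed

lemma over_subset:
  assumes "0 < k" shows "over k n \<subseteq> Y"
proof
  fix y assume "y \<in> over k n"
  then obtain p where "p 0 \<in> X" "\<pi> (p 0) = y"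
    using assms overD[of y k n] by auto
  then show "y \<in> Y" using image by blast
qed

lemma over_mono: "n \<le> n' \<Longrightarrow> over k n \<subseteq> over k n'"
  unfolding over_def using tuples_mono by blast

lemma continuous_on_tuples:
  assumes "0 < k" shows "continuous_on (tuples k n) (\<lambda>p. \<pi> (p 0))"
  by (rule continuous_on_compose2[OF cont continuous_on_coord_power_space])
     (use assms in \<open>auto simp: tuples_def intro: power_space_coord\<close>)

lemma shift_over_iff:
  assumes "0 < k" "y \<in> Y"
  shows "shift y \<in> over k n \<longleftrightarrow> y \<in> over k (n + 1)"
proof
  assume "shift y \<in> over k n"
  then obtain p where p: "p \<in> tuples k n" "\<pi> (p 0) = shift y"
    using assms(1) by (auto simp: over_def)
  then obtain q where q: "q \<in> power_space k X" "power_shift k q = p"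
    using power_shift_preimage[of p k] by (auto simp: tuples_def)
  then have "q \<in> tuples k (n + 1)"
    using power_shift_tuples p(1) by blast
  moreover have "\<pi> (q 0) = y"
  proof -
    have "translate 1 (\<pi> (q 0)) = translate 1 y"
      using p(2) q assms(1) translate_factor_code[OF factor power_space_coord[OF q(1), of 0], of 1]
      by (auto simp: power_shift_def shift_eq_translate)
    then have "translate (-1) (translate 1 (\<pi> (q 0))) = translate (-1) (translate 1 y)"
      by simp
    then show ?thesis by simp
  qed
  ultimately show "y \<in> over k (n + 1)"
    unfolding over_def by blast
next
  assume "y \<in> over k (n + 1)"
  then obtain p where p: "p \<in> tuples k (n + 1)" "\<pi> (p 0) = y" "p 0 \<in> X"
    using assms(1) overD[of y k "n + 1"] by auto
  then have "power_shift k p \<in> tuples k n"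
    using power_shift_tuples by (auto simp: tuples_def)
  moreover have "\<pi> (power_shift k p 0) = shift y"
    using p assms(1) translate_factor_code[OF factor p(3), of 1]
    by (simp add: power_shift_def shift_eq_translate)
  ultimately show "shift y \<in> over k n"
    unfolding over_def by force
qed

text \<open>
  Each of the finitely many pairs of representatives is separated from some time on; a common time is the
  largest of these.
\<close>

lemma inequivalent_tuple:
  assumes e: "inj_on e {..<k}" "e ` {..<k} \<subseteq> transition_classes X \<pi> y" and "0 < k"
  shows "\<exists>n::nat. y \<in> over k (int n)"
proof -
  note eqv = equiv_transition[of y]
  have "\<exists>x\<in>fiber X \<pi> y. e i = transition_equiv X \<pi> y `` {x}" if "i < k" for i
    using e(2) that unfolding transition_classes_def by (auto elim!: quotientE)
  then obtain r where r: "\<And>i. i < k \<Longrightarrow> r i \<in> fiber X \<pi> y"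
      "\<And>i. i < k \<Longrightarrow> e i = transition_equiv X \<pi> y `` {r i}"
    by metis
  define p where "p = restrict r {..<k}"
  have p: "p i \<in> X" "\<pi> (p i) = y" if "i < k" for i
    using r(1)[OF that] that by (auto simp: p_def fiber_def)
  have "\<exists>n. apart n (p i) (p j)" if "i < k" "j < k" "i \<noteq> j" for i j
  proof -
    have "e i \<noteq> e j" using e(1) that by (auto dest: inj_onD)
    then have "(r i, r j) \<notin> transition_equiv X \<pi> y"
      using r that equiv_class_eq[OF eqv] by metis
    then show ?thesis
      using inequivalent_iff_apart[of "p i" "p j" y] p that by (simp add: p_def)
  qed
  then obtain N where N: "\<And>i j. i < k \<Longrightarrow> j < k \<Longrightarrow> i \<noteq> j \<Longrightarrow> apart (N i j) (p i) (p j)"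
    by metis
  define n where "n = nat (Max ((\<lambda>(i, j). N i j) ` ({..<k} \<times> {..<k})))"
  have "N i j \<le> int n" if "i < k" "j < k" for i j
  proof -
    have "N i j \<le> Max ((\<lambda>(i, j). N i j) ` ({..<k} \<times> {..<k}))"
      using that by (intro Max_ge) auto
    then show ?thesis by (simp add: n_def)
  qed
  then have "apart (int n) (p i) (p j)" if "i < k" "j < k" "i \<noteq> j" for i j
    using apart_mono[OF N[OF that]] p that by auto
  then have "p \<in> tuples k (int n)"
    using p unfolding tuples_def power_space_def by (auto simp: p_def)
  then show ?thesis
    unfolding over_def using p(2)[OF assms(3)] by blast
qed

lemma over_imp_classes:
  assumes "y \<in> over k n" "0 < k"
  shows "\<exists>C\<subseteq>transition_classes X \<pi> y. finite C \<and> card C = k"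
proof -
  obtain p where p: "p \<in> tuples k n" "\<forall>i<k. p i \<in> X \<and> \<pi> (p i) = y"
    using overD[OF assms] by auto
  let ?c = "\<lambda>i. transition_class X \<pi> (p i)"
  have "?c ` {..<k} \<subseteq> transition_classes X \<pi> y"
    using p(2) by (auto simp: transition_classes_def transition_class_def fiber_def intro!: quotientI)
  moreover have "card (?c ` {..<k}) = k"
    using card_image[OF tuples_inj[OF p(1)]] by simp
  ultimately show ?thesis by blast
qed

lemma finite_subset_classes_over:
  assumes "C \<subseteq> transition_classes X \<pi> y" "finite C" "0 < card C"
  shows "\<exists>n::nat. y \<in> over (card C) (int n)"
proof -
  obtain e where "bij_betw e {0..<card C} C"
    using ex_bij_betw_nat_finite[OF assms(2)] by blast
  then show ?thesis
    using assms by (intro inequivalent_tuple[of e]) (auto simp: bij_betw_def atLeast0LessThan)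
qed

lemma finite_transition_classes:
  "finite (transition_classes X \<pi> y)" "card (transition_classes X \<pi> y) \<le> CARD('a) ^ nat (2 * R + 1)"
proof -
  have "card C \<le> CARD('a) ^ nat (2 * R + 1)"
    if C: "C \<subseteq> transition_classes X \<pi> y" "finite C" for C
  proof (cases "card C = 0")
    case False
    then obtain n :: nat where "y \<in> over (card C) (int n)"
      using finite_subset_classes_over[OF C] by auto
    then show ?thesis
      using tuples_bound by (auto simp: over_def)
  qed simp
  from finite_if_finite_subsets_card_bdd[OF this]
  show "finite (transition_classes X \<pi> y)"
    "card (transition_classes X \<pi> y) \<le> CARD('a) ^ nat (2 * R + 1)"
    by auto
qed

lemma card_classes_ge_iff:
  assumes "0 < k"
  shows "k \<le> card (transition_classes X \<pi> y) \<longleftrightarrow> (\<exists>n::nat. y \<in> over k (int n))"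
proof
  assume "k \<le> card (transition_classes X \<pi> y)"
  then obtain C where "C \<subseteq> transition_classes X \<pi> y" "card C = k" "finite C"
    by (rule obtain_subset_with_card_n)
  then show "\<exists>n::nat. y \<in> over k (int n)"
    using finite_subset_classes_over[of C y] assms by simp
next
  assume "\<exists>n::nat. y \<in> over k (int n)"
  then obtain n :: nat where "y \<in> over k (int n)" by blast
  from over_imp_classes[OF this assms] obtain C where
      "C \<subseteq> transition_classes X \<pi> y" "card C = k"
    by blast
  then show "k \<le> card (transition_classes X \<pi> y)"
    using card_mono[OF finite_transition_classes(1)] by blast
qed

end

section \<open>The class degree and the joining\<close>

text \<open>
  A product of Hausdorff spaces is Hausdorff.
\<close>

lemma compact_imp_closed_fun:
  fixes S :: "('i \<Rightarrow> 'c::t2_space) set"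
  assumes "compact S" shows "closed S"
proof -
  have "Hausdorff_space (euclidean :: 'c topology)"
    unfolding Hausdorff_space_def disjnt_def using hausdorff by (fastforce simp: open_openin[symmetric])
  then have "Hausdorff_space (product_topology (\<lambda>_::'i. euclidean :: 'c topology) UNIV)"
    by (simp add: Hausdorff_space_product_topology)
  then show ?thesis
    using compactin_imp_closedin[of euclidean S] assms
    by (simp add: euclidean_product_topology)
qed

lemma closed_singleton_fun: "closed {y :: 'i \<Rightarrow> 'c::t2_space}"
  by (intro compact_imp_closed_fun) simp

locale ergodic_base = gluing_code +
  fixes \<nu>
  assumes \<nu>: "borel_prob_measure Y \<nu>" "ergodic_measure shift \<nu>"
begin

sublocale prob_space \<nu>
  using \<nu>(1) by (simp add: borel_prob_measure_def)

lemma space_\<nu> [simp]: "space \<nu> = Y"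
  using \<nu>(1) by (rule space_borel_prob_measure)

lemma inv_\<nu>: "invariant_measure shift \<nu>"
  using \<nu>(2) by (simp add: ergodic_measure_def)

lemma closed_over: "0 < k \<Longrightarrow> closed (over k n)"
  unfolding over_def
  by (intro compact_imp_closed_fun compact_continuous_image continuous_on_tuples compact_tuples)

lemma over_measurable: "0 < k \<Longrightarrow> over k n \<in> sets \<nu>"
  using \<nu>(1) over_subset closed_over
  by (auto simp: borel_prob_measure_def sets_restrict_space intro!: image_eqI[of _ _ "over k n"])

lemma shift_vimage_over:
  assumes "0 < k" shows "shift -` over k n \<inter> Y = over k (n + 1)"
  using shift_over_iff[OF assms] over_subset[OF assms] by blast

text \<open>
  The preimage of \<open>over k n\<close> under the shift is \<open>over k (n + 1)\<close>, and \<open>\<nu>\<close> is invariant. So separation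
  from time \<open>n\<close> on is equally likely for all \<open>n\<close>, although the sets are nested.
\<close>

lemma measure_over_eq:
  assumes "0 < k" shows "prob (over k n) = prob (over k 0)"
proof -
  have step: "prob (over k (n + 1)) = prob (over k n)" for n
    using measure_invariant[OF inv_\<nu> over_measurable[OF assms, of n]]
    by (simp add: shift_vimage_over[OF assms])
  show ?thesis
  proof (induction n rule: int_induct[where k=0])
    case (step1 n)
    then show ?case using step[of n] by simp
  next
    case (step2 n)
    then show ?case using step[of "n - 1"] by simp
  qed simp
qed

lemma measure_Union_over:
  assumes "0 < k" shows "prob (\<Union>n. over k (int n)) = prob (over k 0)"
proof -
  have "(\<lambda>n. prob (over k (int n))) \<longlonglongrightarrow> prob (\<Union>n. over k (int n))"
    using over_measurable[OF assms] over_mono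
    by (intro finite_Lim_measure_incseq) (auto simp: incseq_def)
  moreover have "prob (over k (int n)) = prob (over k 0)" for n
    using assms by (rule measure_over_eq)
  ultimately show ?thesis
    by (simp add: LIMSEQ_const_iff)
qed

lemma measure_over_0_1:
  assumes "0 < k" shows "prob (over k 0) = 0 \<or> prob (over k 0) = 1"
proof -
  let ?A = "\<Union>n. over k (int n)"
  have "shift -` ?A \<inter> space \<nu> = (\<Union>n. shift -` over k (int n) \<inter> Y)"
    by auto
  also have "\<dots> = (\<Union>n. over k (int n + 1))"
    by (simp add: shift_vimage_over[OF assms])
  also have "\<dots> = ?A"
  proof (intro equalityI UN_least)
    show "over k (int n + 1) \<subseteq> ?A" for n
      using UN_upper[of "Suc n" UNIV "\<lambda>n. over k (int n)"] by (simp add: add.commute)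
    show "over k (int n) \<subseteq> (\<Union>n. over k (int n + 1))" for n
      by (rule subset_trans[OF over_mono[of "int n" "int n + 1"]]) auto
  qed
  finally have "shift -` ?A \<inter> space \<nu> = ?A" .
  moreover have "?A \<in> sets \<nu>"
    using over_measurable[OF assms] by auto
  ultimately have "prob ?A = 0 \<or> prob ?A = 1"
    using \<nu>(2) unfolding ergodic_measure_def by blast
  then show ?thesis
    by (simp add: measure_Union_over[OF assms])
qed

lemma measure_over_1: "prob (over 1 0) = 1"
proof -
  have "y \<in> (\<Union>n. over 1 (int n))" if "y \<in> Y" for y
  proof -
    obtain x where "x \<in> fiber X \<pi> y"
    proof -
      have "y \<in> \<pi> ` X" using \<open>y \<in> Y\<close> image by simp
      then show ?thesis using that by (auto simp: fiber_def)
    qed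
    then have "transition_classes X \<pi> y \<noteq> {}"
      by (auto simp: transition_classes_def quotient_def)
    then have "1 \<le> card (transition_classes X \<pi> y)"
      using finite_transition_classes(1) by (simp add: Suc_le_eq card_gt_0_iff)
    then show ?thesis
      using card_classes_ge_iff[of 1 y] by auto
  qed
  then have "(\<Union>n. over 1 (int n)) = Y"
    using over_subset[of 1] by (intro equalityI subsetI UN_least) auto
  then show ?thesis
    using measure_Union_over[of 1] prob_space by simp
qed

text \<open>
  The set of points with at least \<open>k\<close> transition classes is invariant and therefore has measure \<open>0\<close>
  or \<open>1\<close>. The class degree is the largest \<open>k\<close> for which the measure is \<open>1\<close>.
\<close>

lemma class_degree_over:
  defines "c \<equiv> class_degree X \<pi> \<nu>"
  shows "0 < c" "prob (over c 0) = 1"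
proof -
  \<comment> \<open>The bound on the number of pairwise separated points makes \<open>P\<close> finite.\<close>
  define P where "P = {k. 0 < k \<and> prob (over k 0) = 1}"
  have "k \<le> CARD('a) ^ nat (2 * R + 1)" if "k \<in> P" for k
  proof -
    have "over k 0 \<noteq> {}" using that by (auto simp: P_def)
    then show ?thesis using tuples_bound by (auto simp: over_def)
  qed
  then have "finite P"
    by (intro finite_subset[of P "{..CARD('a) ^ nat (2 * R + 1)}"]) auto
  moreover have "1 \<in> P" using measure_over_1 by (simp add: P_def)
  ultimately have max: "Max P \<in> P" "Max P + 1 \<notin> P"
    using Max_in[of P] Max_ge[of P "Max P + 1"] by (blast, linarith)
  define d where "d = Max P"
  have d: "0 < d" "prob (over d 0) = 1" and "prob (over (d + 1) 0) = 0"
    using max measure_over_0_1[of "d + 1"] by (auto simp: P_def d_def)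
  have "AE y in \<nu>. y \<in> (\<Union>n. over d (int n))"
    using d measure_Union_over by (intro AE_prob_1) simp
  moreover have "AE y in \<nu>. y \<notin> (\<Union>n. over (d + 1) (int n))"
    using \<open>prob (over (d + 1) 0) = 0\<close> measure_Union_over[of "d + 1"] over_measurable[of "d + 1"]
    by (intro AE_not_in null_setsI) (auto simp: emeasure_eq_measure)
  ultimately have AE: "AE y in \<nu>. finite (transition_classes X \<pi> y) \<and> card (transition_classes X \<pi> y) = d"
  proof eventually_elim
    case (elim y)
    have "d \<le> card (transition_classes X \<pi> y)" "\<not> d + 1 \<le> card (transition_classes X \<pi> y)"
      using card_classes_ge_iff[of d y] card_classes_ge_iff[of "d + 1" y] elim d(1) by auto
    then show ?case using finite_transition_classes(1) by simp
  qed
  have "c = d"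
    unfolding c_def class_degree_def
  proof (rule the_equality)
    show "AE y in \<nu>. finite (transition_classes X \<pi> y) \<and> card (transition_classes X \<pi> y) = d"
      by (rule AE)
    fix c' assume "AE y in \<nu>. finite (transition_classes X \<pi> y) \<and> card (transition_classes X \<pi> y) = c'"
    with AE have "AE y in \<nu>. c' = d"
      by eventually_elim simp
    then show "c' = d" by simp
  qed
  then show "0 < c" "prob (over c 0) = 1" using d by auto
qed

text \<open>
  The tuples whose entries are separated at all times: a compact shift-invariant set.
\<close>

definition core :: "nat \<Rightarrow> (nat \<Rightarrow> int \<Rightarrow> 'a) set" where
  "core k = (\<Inter>n. tuples k (- int n))"

lemma decseq_tuples: "decseq (\<lambda>n. tuples k (- int n))"
  unfolding decseq_def by (intro allI impI tuples_mono) simp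

text \<open>
  Over a point of the right-hand side the tuples separated from time \<open>-n\<close> on form a decreasing sequence of
  nonempty compact sets.
\<close>

lemma image_core:
  assumes "0 < k"
  shows "(\<lambda>p. \<pi> (p 0)) ` core k = (\<Inter>n. over k (- int n))"
proof
  show "(\<lambda>p. \<pi> (p 0)) ` core k \<subseteq> (\<Inter>n. over k (- int n))"
    by (auto simp: core_def over_def)
  show "(\<Inter>n. over k (- int n)) \<subseteq> (\<lambda>p. \<pi> (p 0)) ` core k"
  proof
    fix y assume y: "y \<in> (\<Inter>n. over k (- int n))"
    define A where "A n = tuples k (- int n) \<inter> (\<lambda>p. \<pi> (p 0)) -` {y}" for n
    have closed: "closed (A n)" for n
      unfolding A_def using continuous_on_tuples[OF assms] closed_tuples closed_singleton_fun
      by (rule continuous_closed_preimage)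
    have "(\<Inter>n. A n) \<noteq> {}"
    proof (rule compact_nested)
      show "compact (A n)" for n
        using compact_Int_closed[OF compact_tuples[of k "- int n"] closed[of n]]
        by (simp add: A_def Int_absorb1)
      show "decseq A"
        using decseq_tuples[of k] unfolding decseq_def A_def by blast
      show "A n \<noteq> {}" for n
        using y by (auto simp: A_def over_def)
    qed (rule closed)
    then obtain p where "p \<in> (\<Inter>n. A n)" by blast
    then show "y \<in> (\<lambda>p. \<pi> (p 0)) ` core k"
      by (intro image_eqI[of _ _ p]) (auto simp: A_def core_def)
  qed
qed

lemma measure_image_core:
  assumes "0 < k" "prob (over k 0) = 1"
  shows "(\<lambda>p. \<pi> (p 0)) ` core k \<in> sets \<nu>" "prob ((\<lambda>p. \<pi> (p 0)) ` core k) = 1"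
proof -
  show "(\<lambda>p. \<pi> (p 0)) ` core k \<in> sets \<nu>"
    unfolding image_core[OF assms(1)] using over_measurable[OF assms(1)] by (intro sets.countable_INT) auto
  have "decseq (\<lambda>n. over k (- int n))"
    unfolding decseq_def by (intro allI impI over_mono) simp
  then have "(\<lambda>n. prob (over k (- int n))) \<longlonglongrightarrow> prob (\<Inter>n. over k (- int n))"
    using over_measurable[OF assms(1)] by (intro finite_Lim_measure_decseq) auto
  moreover have "prob (over k (- int n)) = 1" for n
    using measure_over_eq[OF assms(1), of "- int n"] assms(2) by simp
  ultimately show "prob ((\<lambda>p. \<pi> (p 0)) ` core k) = 1"
    unfolding image_core[OF assms(1)] by (simp add: LIMSEQ_const_iff)
qed

lemma core_subset: "core k \<subseteq> tuples k n"
proof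
  fix p assume "p \<in> core k"
  then have "p \<in> tuples k (- int (nat (- n)))"
    unfolding core_def by blast
  \<comment> \<open>This number is the minimum of \<open>n\<close> and \<open>0\<close>; only nonpositive times enter the definition of the core.\<close>
  moreover have "- int (nat (- n)) \<le> n" by simp
  ultimately show "p \<in> tuples k n"
    using tuples_mono by blast
qed

lemma core_props:
  "core k \<subseteq> power_space k X" "closed (core k)" "compact (core k)" "power_shift k ` core k \<subseteq> core k"
proof -
  show sub: "core k \<subseteq> power_space k X"
    using core_subset tuples_subset_power_space by blast
  show closed: "closed (core k)"
    unfolding core_def by (intro closed_INT ballI closed_tuples)
  then show "compact (core k)"
    using compact_Int_closed[OF compact_tuples[of k 0]] core_subset by (metis inf.absorb2)
  show "power_shift k ` core k \<subseteq> core k"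
  proof safe
    fix p assume p: "p \<in> core k"
    have "power_shift k p \<in> tuples k (- int n)" for n
      using power_shift_tuples[of p k] p sub core_subset by blast
    then show "power_shift k p \<in> core k" by (simp add: core_def)
  qed
qed

lemma power_shift_in: "p \<in> power_space k X \<Longrightarrow> power_shift k p \<in> power_space k X"
  using translate_factor_code[OF factor]
  by (auto simp: power_space_def power_shift_def shift_eq_translate)

text \<open>
  An ergodic lift of \<open>\<nu>\<close> to the core is already a class separating joining; it only has to be regarded as a
  measure on the whole power of \<open>X\<close>.
\<close>

theorem ergodic_separating_joining_exists:
  defines "c \<equiv> class_degree X \<pi> \<nu>"
  shows "\<exists>L. relative_joining X \<pi> c L \<and> joining_over \<pi> c L \<nu> \<and>
           ergodic_measure (power_shift c) L \<and> class_separating X \<pi> c L"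
proof -
  define K where "K = core c"
  define Z where "Z = power_space c X"
  define T where "T = (power_shift c :: (nat \<Rightarrow> int \<Rightarrow> 'a) \<Rightarrow> _)"
  define \<psi> where "\<psi> = (\<lambda>p :: nat \<Rightarrow> int \<Rightarrow> 'a. \<pi> (p 0))"
  have c: "0 < c" "prob (over c 0) = 1"
    using class_degree_over by (simp_all add: c_def)
  have K: "K \<subseteq> Z" "closed K" "compact K" "T ` K \<subseteq> K"
    using core_props[of c] by (simp_all add: K_def Z_def T_def)
  have TZ: "T ` Z \<subseteq> Z"
    using power_shift_in by (auto simp: T_def Z_def)
  have Kt: "p \<in> tuples c 0" if "p \<in> K" for p
    using that core_subset by (auto simp: K_def)
  have cont_T: "continuous_on S T" for S
    unfolding T_def by (rule power_shift_continuous)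
  have equi: "\<psi> (T p) = shift (\<psi> p)" if "p \<in> K" for p
  proof -
    have "p 0 \<in> X" using Kt[OF that] c(1) by (rule tuplesD)
    then show ?thesis
      using factor c(1) by (simp add: \<psi>_def T_def power_shift_def factor_code_def)
  qed
  obtain \<B>a :: "(int \<Rightarrow> 'a) set set" where "clopen_basis \<B>a"
    using clopen_basis_fun[OF clopen_basis_discrete] by blast
  then obtain \<B> :: "(nat \<Rightarrow> int \<Rightarrow> 'a) set set" where \<B>: "clopen_basis \<B>"
    using clopen_basis_fun by blast
  obtain \<C> :: "(int \<Rightarrow> 'b) set set" where \<C>: "clopen_basis \<C>"
    using clopen_basis_fun[OF clopen_basis_discrete] by blast
  have cont_\<psi>: "continuous_on K \<psi>"
    unfolding \<psi>_def K_def
    by (rule continuous_on_subset[OF continuous_on_tuples[OF c(1)] core_subset])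
  obtain M where M: "borel_prob_measure K M" "ergodic_measure T M" "distr M \<nu> \<psi> = \<nu>"
  proof -
    have image: "\<psi> ` K \<in> sets \<nu>" "prob (\<psi> ` K) = 1"
      using measure_image_core[OF c] by (simp_all add: \<psi>_def K_def)
    have "\<exists>M. borel_prob_measure K M \<and> ergodic_measure T M \<and> distr M \<nu> \<psi> = \<nu>"
      by (rule ergodic_lift[OF \<B> \<C> K(3,2) borel_closed[OF closed_Y] cont_T K(4) cont_\<psi> _ \<nu> image])
         (rule equi)
    then show ?thesis using that by blast
  qed
  interpret M: prob_space M using M(1) by (simp add: borel_prob_measure_def)
  have space_M: "space M = K" using M(1) by (rule space_borel_prob_measure)
  have sets_M: "sets M = sets (restrict_space borel K)"
    using M(1) by (simp add: borel_prob_measure_def)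
  define ZB where "ZB = restrict_space (borel :: (nat \<Rightarrow> int \<Rightarrow> 'a) measure) Z"
  have id: "(\<lambda>p. p) \<in> measurable M ZB"
    using M(1) by (rule measurable_borel_prob_measure) (use K(1) in \<open>auto simp: ZB_def\<close>)
  \<comment> \<open>\<open>L\<close> is \<open>M\<close>, extended by zero from the core to the whole power of \<open>X\<close>.\<close>
  define L where "L = distr M ZB (\<lambda>p. p)"
  have L: "borel_prob_measure Z L"
    unfolding L_def using M(1) id by (rule borel_prob_measure_distr) (simp add: ZB_def)
  interpret L: prob_space L using L by (simp add: borel_prob_measure_def)
  have space_L: "space L = Z" using L by (rule space_borel_prob_measure)
  have sets_L [simp]: "sets L = sets ZB" by (simp add: L_def)
  have meas_L: "measure L A = measure M (A \<inter> K)" if "A \<in> sets L" for A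
    using measure_distr[OF id, of A] that by (simp add: L_def space_M)
  have K_L: "K \<in> sets L"
    using K(1,2) by (auto simp: ZB_def sets_restrict_space intro!: image_eqI[of _ _ K])
  have AE_K: "AE p in L. p \<in> K"
    using meas_L[OF K_L] M.prob_space space_M by (intro L.AE_prob_1) simp
  have inv_M: "invariant_measure T M"
    using M(2) by (simp add: ergodic_measure_def)
  have T_M: "T \<in> measurable M M"
    using inv_M by (simp add: invariant_measure_def)
  have T_ZB: "T \<in> measurable ZB ZB"
    unfolding ZB_def using cont_T TZ
    by (intro measurable_restrict_space2 borel_measurable_continuous_on_restrict)
       (auto simp: space_restrict_space)
  then have T_L: "T \<in> measurable L L"
    using measurable_cong_sets[OF sets_L sets_L] by blast
  have "distr L L T = L"
  proof -
    have "distr L L T = distr L ZB T"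
      by (rule distr_cong) auto
    also have "\<dots> = distr M ZB (T \<circ> (\<lambda>p. p))"
      unfolding L_def using T_ZB id by (rule distr_distr)
    also have "\<dots> = distr M ZB ((\<lambda>p. p) \<circ> T)"
      by (simp add: comp_def)
    also have "\<dots> = distr (distr M M T) ZB (\<lambda>p. p)"
      using id T_M by (rule distr_distr[symmetric])
    also have "\<dots> = L"
      using inv_M by (simp add: invariant_measure_def L_def)
    finally show ?thesis .
  qed
  then have inv_L: "invariant_measure T L"
    using T_L by (simp add: invariant_measure_def)
  have "ergodic_measure T L"
    unfolding ergodic_measure_def
  proof (intro conjI inv_L ballI impI)
    fix A assume A: "A \<in> sets L" "T -` A \<inter> space L = A"
    have "A \<inter> K \<in> sets M"
      using measurable_sets[OF id, of A] A(1) by (simp add: space_M)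
    moreover have "T -` (A \<inter> K) \<inter> space M = A \<inter> K"
    proof -
      have "T p \<in> A \<longleftrightarrow> p \<in> A" "T p \<in> K" if "p \<in> K" for p
        using A(2) K(1,4) that by (auto simp: space_L)
      then show ?thesis by (auto simp: space_M)
    qed
    ultimately have "measure M (A \<inter> K) = 0 \<or> measure M (A \<inter> K) = 1"
      using M(2) unfolding ergodic_measure_def by blast
    then show "measure L A = 0 \<or> measure L A = 1"
      using meas_L[OF A(1)] by simp
  qed
  moreover have "relative_joining X \<pi> c L"
    unfolding relative_joining_def
  proof (intro conjI)
    show "borel_prob_measure (power_space c X) L" using L by (simp add: Z_def)
    show "invariant_measure (power_shift c) L" using inv_L by (simp add: T_def)
    show "AE x in L. \<forall>i<c. \<forall>j<c. \<pi> (x i) = \<pi> (x j)"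
      using AE_K by eventually_elim (blast intro: tuplesD(2)[OF Kt])
  qed
  moreover have "class_separating X \<pi> c L"
    unfolding class_separating_def
    using AE_K by eventually_elim (rule tuples_inj[OF Kt])
  moreover have "joining_over \<pi> c L \<nu>"
  proof -
    have "\<psi> \<in> measurable L \<nu>"
      using L
    proof (rule measurable_borel_prob_measure)
      show "continuous_on Z \<psi>"
        unfolding \<psi>_def
        by (rule continuous_on_compose2[OF cont continuous_on_coord_power_space])
           (use c(1) power_space_coord in \<open>auto simp: Z_def\<close>)
      show "\<psi> ` Z \<subseteq> Y"
        using image power_space_coord[OF _ c(1)] by (auto simp: \<psi>_def Z_def)
      show "sets \<nu> = sets (restrict_space borel Y)"
        using \<nu>(1) by (simp add: borel_prob_measure_def)
    qed
    then have "\<psi> \<in> measurable ZB \<nu>"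
      using measurable_cong_sets[OF sets_L refl] by blast
    then have "distr L \<nu> \<psi> = distr M \<nu> (\<psi> \<circ> (\<lambda>p. p))"
      unfolding L_def using id by (rule distr_distr)
    then have "distr L \<nu> \<psi> = \<nu>"
      using M(3) by (simp add: comp_def)
    then show ?thesis
      unfolding joining_over_def \<psi>_def using c(1) by blast
  qed
  ultimately show ?thesis
    unfolding T_def by blast
qed

end

theorem theorem9p4:
  fixes X :: "(int \<Rightarrow> 'a::alphabet) set"
    and Y :: "(int \<Rightarrow> 'b::alphabet) set"
    and \<pi> :: "(int \<Rightarrow> 'a) \<Rightarrow> (int \<Rightarrow> 'b)"
    and \<nu> :: "(int \<Rightarrow> 'b) measure"
  assumes "SFT X"
    and "factor_code X Y \<pi>"
    and "borel_prob_measure Y \<nu>"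
    and "ergodic_measure shift \<nu>"
  shows "\<exists>L. relative_joining X \<pi> (class_degree X \<pi> \<nu>) L \<and>
             joining_over \<pi> (class_degree X \<pi> \<nu>) L \<nu> \<and>
             ergodic_measure (power_shift (class_degree X \<pi> \<nu>)) L \<and>
             class_separating X \<pi> (class_degree X \<pi> \<nu>) L"
proof -
  obtain R where "gluing_code X Y \<pi> R"
    using gluing_code_SFT[OF assms(1,2)] by blast
  then interpret ergodic_base X Y \<pi> R \<nu>
    using assms(3,4) by (simp add: ergodic_base_def ergodic_base_axioms_def)
  show ?thesis by (rule ergodic_separating_joining_exists)
qed

end
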